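(* The category $\mathbf{Mon}$ is a subcategory of $\mathbf{SyMon}$, $\mathbf{Rel}$, $\mathbf{Aff}$ and $\mathbf{Cart}$. The category $\mathbf{SyMon}$ is a subcategory of $\mathbf{Rel}$, $\mathbf{Aff}$ and $\mathbf{Cart}$. The categories $\mathbf{Rel}$ and $\mathbf{Aff}$ are subcategories of $\mathbf{Cart}$. Here, in each case, "$\mathcal C$ is a subcategory of $\mathcal D$" means that the assignment $E(A)=A$ for every object $A\in\mathcal O$, $E([f]_{\mathcal C})=[f]_{\mathcal D}$ for every $\mathcal C$ morphism-term $f$, is an embedding of $\mathcal C$ into $\mathcal D$ (a well-defined functor, injective on objects and on morphisms).
   Context: **Free categories.** Let $P$ be an infinite linearly ordered set of letters and $\mathcal O$ the set of terms freely generated from $P\cup\{\mathrm I\}$ by the binary operation $\cdot$. For each of the five categories the set of objects is $\mathcal O$. Primitive morphism-terms (for all $A,B,C\in\mathcal O$): for $\mathbf{Mon}$: $1_A:A\to A$, $\sigma_A:\mathrm I\cdot A\to A$, $\sigma^i_A:A\to\mathrm I\cdot A$, $\delta_A:A\cdot\mathrm I\to A$, $\delta^i_A:A\to A\cdot\mathrm I$, $\overrightarrow{b}_{A,B,C}:A\cdot(B\cdot C)\to(A\cdot B)\cdot C$, $\overleftarrow{b}_{A,B,C}:(A\cdot B)\cdot C\to A\cdot(B\cdot C)$; for $\mathbf{SyMon}$: those of $\mathbf{Mon}$ and $c_{A,B}:A\cdot B\to B\cdot A$; for $\mathbf{Rel}$: those of $\mathbf{SyMon}$ and $w_A:A\to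 A\cdot A$; for $\mathbf{Aff}$: those of $\mathbf{SyMon}$ and $k_A:A\to\mathrm I$; for $\mathbf{Cart}$: those of $\mathbf{Rel}$ and $\mathbf{Aff}$. Morphism-terms are built from primitive ones by (typed) composition $gf$ (first $f$, then $g$) and multiplication $f\cdot g:A\cdot B\to C\cdot D$ for $f:A\to C$, $g:B\to D$. Morphisms are equivalence classes $[f]_{\mathcal C}$ of morphism-terms modulo the smallest equivalence relation (on terms of the same type) that is a congruence for composition and multiplication and contains all instances of the following equations: For $\mathbf{Mon}$ (monoidal equations): $f1_A=f=1_Bf$; $h(gf)=(hg)f$; $(g_1f_1)\cdot(g_2f_2)=(g_1\cdot g_2)(f_1\cdot f_2)$; $1_A\cdot 1_B=1_{A\cdot B}$; $f\sigma_A=\sigma_B(1_{\mathrm I}\cdot f)$ and $f\delta_A=\delta_B(f\cdot 1_{\mathrm I})$ for $f:A\to B$; $\sigma_A\sigma^i_A=1_A$, $\sigma^i_A\sigma_A=1_{\mathrm I\cdot A}$, $\delta_A\delta^i_A=1_A$, $\delta^i_A\delta_A=1_{A\cdot\mathrm I}$; $\sigma_{\mathrm I}=\delta_{\mathrm I}$; $((f\cdot g)\cdot h)\overrightarrow{b}_{A,B,C}=\overrightarrow{b}_{D,E,F}(f\cdot(g\cdot h))$ for $f:A\to D$, $g:B\to E$, $h:C\to F$; $\overrightarrow{b}_{A,B,C}\overleftarrow{b}_{A,B,C}=1$, $\overleftarrow{b}_{A,B,C}\overrightarrow{b}_{A,B,C}=1$; $(\delta_A\cdot 1_B)\overrightarrow{b}_{A,\mathrm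 I,B}=1_A\cdot\sigma_B$; $\overrightarrow{b}_{A\cdot B,C,D}\overrightarrow{b}_{A,B,C\cdot D}=(\overrightarrow{b}_{A,B,C}\cdot 1_D)\overrightarrow{b}_{A,B\cdot C,D}(1_A\cdot\overrightarrow{b}_{B,C,D})$. For $\mathbf{SyMon}$, additionally: $(g\cdot f)c_{A,B}=c_{C,D}(f\cdot g)$ for $f:A\to C$, $g:B\to D$; $c_{B,A}c_{A,B}=1_{A\cdot B}$; $\sigma_Ac_{A,\mathrm I}=\delta_A$; $\overrightarrow{b}_{C,A,B}c_{A\cdot B,C}\overrightarrow{b}_{A,B,C}=(c_{A,C}\cdot 1_B)\overrightarrow{b}_{A,C,B}(1_A\cdot c_{B,C})$. For $\mathbf{Rel}$, those of $\mathbf{SyMon}$ and the $w$-equations: $(f\cdot f)w_A=w_Bf$ for $f:A\to B$; $\sigma_{\mathrm I}w_{\mathrm I}=1_{\mathrm I}$; $\overrightarrow{b}_{A,A,A}(1_A\cdot w_A)w_A=(w_A\cdot 1_A)w_A$; $c_{A,A}w_A=w_A$; $c^m_{A,B,A,B}w_{A\cdot B}=w_A\cdot w_B$, where $c^m_{A,B,C,D}=\overrightarrow{b}_{A,C,B\cdot D}(1_A\cdot(\overleftarrow{b}_{C,B,D}(c_{B,C}\cdot 1_D)\overrightarrow{b}_{B,C,D}))\overleftarrow{b}_{A,B,C\cdot D}$. For $\mathbf{Aff}$, those of $\mathbf{SyMon}$ and the $k$-equations: $k_A=k_Bf$ for $f:A\to B$; $k_{\mathrm I}=1_{\mathrm I}$.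 For $\mathbf{Cart}$, those of $\mathbf{Rel}$ and $\mathbf{Aff}$ and: $\sigma_A(k_A\cdot 1_A)w_A=1_A$, $\delta_A(1_A\cdot k_A)w_A=1_A$. *)

theory Defs
  imports Main
begin

section \<open>Categories, functors, embeddings\<close>

record ('o, 'm) cat_data =
  Ob :: "'o set"
  Hom :: "'o \<Rightarrow> 'o \<Rightarrow> 'm set"
  Ident :: "'o \<Rightarrow> 'm"
  Cmp :: "'m \<Rightarrow> 'm \<Rightarrow> 'm"  \<comment> \<open>\<open>Cmp C g f\<close>: first \<open>f\<close>, then \<open>g\<close>; only meaningful on composable pairs\<close>

locale category =
  fixes C :: "('o, 'm) cat_data"
  assumes hom_ob: "f \<in> Hom C A B \<Longrightarrow> A \<in> Ob C \<and> B \<in> Ob C"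
    and hom_disjoint: "f \<in> Hom C A B \<Longrightarrow> f \<in> Hom C A' B' \<Longrightarrow> A = A' \<and> B = B'"
    and ident_hom: "A \<in> Ob C \<Longrightarrow> Ident C A \<in> Hom C A A"
    and cmp_hom: "f \<in> Hom C A B \<Longrightarrow> g \<in> Hom C B D \<Longrightarrow> Cmp C g f \<in> Hom C A D"
    and cmp_ident_right: "f \<in> Hom C A B \<Longrightarrow> Cmp C f (Ident C A) = f"
    and cmp_ident_left: "f \<in> Hom C A B \<Longrightarrow> Cmp C (Ident C B) f = f"
    and cmp_assoc: "f \<in> Hom C A B \<Longrightarrow> g \<in> Hom C B D \<Longrightarrow> h \<in> Hom C D E \<Longrightarrow>
          Cmp C h (Cmp C g f) = Cmp C (Cmp C h g) f"

definition Mor :: "('o, 'm) cat_data \<Rightarrow> 'm set" where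
  "Mor C = (\<Union>A\<in>Ob C. \<Union>B\<in>Ob C. Hom C A B)"

locale category_functor = source: category C + target: category D
  for C :: "('o, 'm) cat_data" and D :: "('o', 'm') cat_data" +
  fixes Fo :: "'o \<Rightarrow> 'o'" and Fm :: "'m \<Rightarrow> 'm'"
  assumes functor_ob: "A \<in> Ob C \<Longrightarrow> Fo A \<in> Ob D"
    and functor_hom: "f \<in> Hom C A B \<Longrightarrow> Fm f \<in> Hom D (Fo A) (Fo B)"
    and functor_ident: "A \<in> Ob C \<Longrightarrow> Fm (Ident C A) = Ident D (Fo A)"
    and functor_cmp: "f \<in> Hom C A B \<Longrightarrow> g \<in> Hom C B B' \<Longrightarrow>
          Fm (Cmp C g f) = Cmp D (Fm g) (Fm f)"

locale category_embedding = category_functor +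
  assumes inj_ob: "inj_on Fo (Ob C)"
    and inj_mor: "inj_on Fm (Mor C)"

section \<open>Objects and morphism-terms\<close>

datatype 'p obj = Letter 'p | I | Prod "'p obj" "'p obj" (infixr "\<otimes>" 75)

datatype kind = Mon | SyMon | Rel | Aff | Cart

definition has_c :: "kind \<Rightarrow> bool" where "has_c \<C> \<longleftrightarrow> \<C> \<in> {SyMon, Rel, Aff, Cart}"
definition has_w :: "kind \<Rightarrow> bool" where "has_w \<C> \<longleftrightarrow> \<C> \<in> {Rel, Cart}"
definition has_k :: "kind \<Rightarrow> bool" where "has_k \<C> \<longleftrightarrow> \<C> \<in> {Aff, Cart}"

text \<open>Raw terms; the morphism-terms of a given category are those typed by \<open>has_type\<close>.\<close>

datatype 'p mterm =
    one "'p obj"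
  | \<sigma> "'p obj" | \<sigma>i "'p obj"
  | \<delta> "'p obj" | \<delta>i "'p obj"
  | br "'p obj" "'p obj" "'p obj"
  | bl "'p obj" "'p obj" "'p obj"
  | cc "'p obj" "'p obj"
  | ww "'p obj"
  | kk "'p obj"
  | Compose "'p mterm" "'p mterm" (infixr "\<bullet>" 65)
  | Multiply "'p mterm" "'p mterm" (infixr "\<star>" 70)

inductive has_type :: "kind \<Rightarrow> 'p mterm \<Rightarrow> 'p obj \<Rightarrow> 'p obj \<Rightarrow> bool"
    ("_ \<turnstile> _ : _ \<rightarrow> _" [50, 50, 50, 50] 50) for \<C> :: kind where
  "\<C> \<turnstile> one A : A \<rightarrow> A"
| "\<C> \<turnstile> \<sigma> A : I \<otimes> A \<rightarrow> A"
| "\<C> \<turnstile> \<sigma>i A : A \<rightarrow> I \<otimes> A"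
| "\<C> \<turnstile> \<delta> A : A \<otimes> I \<rightarrow> A"
| "\<C> \<turnstile> \<delta>i A : A \<rightarrow> A \<otimes> I"
| "\<C> \<turnstile> br A B C : A \<otimes> (B \<otimes> C) \<rightarrow> (A \<otimes> B) \<otimes> C"
| "\<C> \<turnstile> bl A B C : (A \<otimes> B) \<otimes> C \<rightarrow> A \<otimes> (B \<otimes> C)"
| "has_c \<C> \<Longrightarrow> \<C> \<turnstile> cc A B : A \<otimes> B \<rightarrow> B \<otimes> A"
| "has_w \<C> \<Longrightarrow> \<C> \<turnstile> ww A : A \<rightarrow> A \<otimes> A"
| "has_k \<C> \<Longrightarrow> \<C> \<turnstile> kk A : A \<rightarrow> I"
| "\<C> \<turnstile> f : A \<rightarrow> B \<Longrightarrow> \<C> \<turnstile> g : B \<rightarrow> C \<Longrightarrow> \<C> \<turnstile> g \<bullet> f : A \<rightarrow> C"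
| "\<C> \<turnstile> f : A \<rightarrow> C \<Longrightarrow> \<C> \<turnstile> g : B \<rightarrow> D \<Longrightarrow> \<C> \<turnstile> f \<star> g : A \<otimes> B \<rightarrow> C \<otimes> D"

section \<open>Equations\<close>

text \<open>In each group the term variables range over the morphism-terms of the category
  \<open>\<C>\<close> at hand, not only over those of the category that introduces the group.\<close>

inductive monoidal_eq :: "kind \<Rightarrow> 'p mterm \<Rightarrow> 'p mterm \<Rightarrow> bool" for \<C> :: kind where
  "\<C> \<turnstile> f : A \<rightarrow> B \<Longrightarrow> monoidal_eq \<C> (f \<bullet> one A) f"
| "\<C> \<turnstile> f : A \<rightarrow> B \<Longrightarrow> monoidal_eq \<C> (one B \<bullet> f) f"
| "\<C> \<turnstile> f : A \<rightarrow> B \<Longrightarrow> \<C> \<turnstile> g : B \<rightarrow> C \<Longrightarrow> \<C> \<turnstile> h : C \<rightarrow> D \<Longrightarrow>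
     monoidal_eq \<C> (h \<bullet> (g \<bullet> f)) ((h \<bullet> g) \<bullet> f)"
| "\<C> \<turnstile> f1 : A1 \<rightarrow> B1 \<Longrightarrow> \<C> \<turnstile> g1 : B1 \<rightarrow> C1 \<Longrightarrow> \<C> \<turnstile> f2 : A2 \<rightarrow> B2 \<Longrightarrow> \<C> \<turnstile> g2 : B2 \<rightarrow> C2 \<Longrightarrow>
     monoidal_eq \<C> ((g1 \<bullet> f1) \<star> (g2 \<bullet> f2)) ((g1 \<star> g2) \<bullet> (f1 \<star> f2))"
| "monoidal_eq \<C> (one A \<star> one B) (one (A \<otimes> B))"
| "\<C> \<turnstile> f : A \<rightarrow> B \<Longrightarrow> monoidal_eq \<C> (f \<bullet> \<sigma> A) (\<sigma> B \<bullet> (one I \<star> f))"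
| "\<C> \<turnstile> f : A \<rightarrow> B \<Longrightarrow> monoidal_eq \<C> (f \<bullet> \<delta> A) (\<delta> B \<bullet> (f \<star> one I))"
| "monoidal_eq \<C> (\<sigma> A \<bullet> \<sigma>i A) (one A)"
| "monoidal_eq \<C> (\<sigma>i A \<bullet> \<sigma> A) (one (I \<otimes> A))"
| "monoidal_eq \<C> (\<delta> A \<bullet> \<delta>i A) (one A)"
| "monoidal_eq \<C> (\<delta>i A \<bullet> \<delta> A) (one (A \<otimes> I))"
| "monoidal_eq \<C> (\<sigma> I) (\<delta> I)"
| "\<C> \<turnstile> f : A \<rightarrow> D \<Longrightarrow> \<C> \<turnstile> g : B \<rightarrow> E \<Longrightarrow> \<C> \<turnstile> h : C \<rightarrow> F \<Longrightarrow>
     monoidal_eq \<C> (((f \<star> g) \<star> h) \<bullet> br A B C) (br D E F \<bullet> (f \<star> (g \<star> h)))"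
| "monoidal_eq \<C> (br A B C \<bullet> bl A B C) (one ((A \<otimes> B) \<otimes> C))"
| "monoidal_eq \<C> (bl A B C \<bullet> br A B C) (one (A \<otimes> (B \<otimes> C)))"
| "monoidal_eq \<C> ((\<delta> A \<star> one B) \<bullet> br A I B) (one A \<star> \<sigma> B)"
| "monoidal_eq \<C> (br (A \<otimes> B) C D \<bullet> br A B (C \<otimes> D))
     ((br A B C \<star> one D) \<bullet> (br A (B \<otimes> C) D \<bullet> (one A \<star> br B C D)))"

inductive c_eq :: "kind \<Rightarrow> 'p mterm \<Rightarrow> 'p mterm \<Rightarrow> bool" for \<C> :: kind where
  "\<C> \<turnstile> f : A \<rightarrow> C \<Longrightarrow> \<C> \<turnstile> g : B \<rightarrow> D \<Longrightarrow> c_eq \<C> ((g \<star> f) \<bullet> cc A B) (cc C D \<bullet> (f \<star> g))"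
| "c_eq \<C> (cc B A \<bullet> cc A B) (one (A \<otimes> B))"
| "c_eq \<C> (\<sigma> A \<bullet> cc A I) (\<delta> A)"
| "c_eq \<C> (br C A B \<bullet> (cc (A \<otimes> B) C \<bullet> br A B C))
     ((cc A C \<star> one B) \<bullet> (br A C B \<bullet> (one A \<star> cc B C)))"

definition cm :: "'p obj \<Rightarrow> 'p obj \<Rightarrow> 'p obj \<Rightarrow> 'p obj \<Rightarrow> 'p mterm" where
  "cm A B C D =
     br A C (B \<otimes> D) \<bullet>
       ((one A \<star> (bl C B D \<bullet> ((cc B C \<star> one D) \<bullet> br B C D))) \<bullet> bl A B (C \<otimes> D))"

inductive w_eq :: "kind \<Rightarrow> 'p mterm \<Rightarrow> 'p mterm \<Rightarrow> bool" for \<C> :: kind where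
  "\<C> \<turnstile> f : A \<rightarrow> B \<Longrightarrow> w_eq \<C> ((f \<star> f) \<bullet> ww A) (ww B \<bullet> f)"
| "w_eq \<C> (\<sigma> I \<bullet> ww I) (one I)"
| "w_eq \<C> (br A A A \<bullet> ((one A \<star> ww A) \<bullet> ww A)) ((ww A \<star> one A) \<bullet> ww A)"
| "w_eq \<C> (cc A A \<bullet> ww A) (ww A)"
| "w_eq \<C> (cm A B A B \<bullet> ww (A \<otimes> B)) (ww A \<star> ww B)"

inductive k_eq :: "kind \<Rightarrow> 'p mterm \<Rightarrow> 'p mterm \<Rightarrow> bool" for \<C> :: kind where
  "\<C> \<turnstile> f : A \<rightarrow> B \<Longrightarrow> k_eq \<C> (kk A) (kk B \<bullet> f)"
| "k_eq \<C> (kk I) (one I)"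

inductive wk_eq :: "'p mterm \<Rightarrow> 'p mterm \<Rightarrow> bool" where
  "wk_eq (\<sigma> A \<bullet> ((kk A \<star> one A) \<bullet> ww A)) (one A)"
| "wk_eq (\<delta> A \<bullet> ((one A \<star> kk A) \<bullet> ww A)) (one A)"

definition equation :: "kind \<Rightarrow> 'p mterm \<Rightarrow> 'p mterm \<Rightarrow> bool" where
  "equation \<C> s t \<longleftrightarrow>
     monoidal_eq \<C> s t \<or>
     (has_c \<C> \<and> c_eq \<C> s t) \<or>
     (has_w \<C> \<and> w_eq \<C> s t) \<or>
     (has_k \<C> \<and> k_eq \<C> s t) \<or>
     (has_w \<C> \<and> has_k \<C> \<and> wk_eq s t)"

inductive_set term_equiv :: "kind \<Rightarrow> ('p mterm \<times> 'p mterm) set" for \<C> :: kind where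
  "equation \<C> s t \<Longrightarrow> (s, t) \<in> term_equiv \<C>"
| "\<C> \<turnstile> f : A \<rightarrow> B \<Longrightarrow> (f, f) \<in> term_equiv \<C>"
| "(f, g) \<in> term_equiv \<C> \<Longrightarrow> (g, f) \<in> term_equiv \<C>"
| "(f, g) \<in> term_equiv \<C> \<Longrightarrow> (g, h) \<in> term_equiv \<C> \<Longrightarrow> (f, h) \<in> term_equiv \<C>"
| "(f, f') \<in> term_equiv \<C> \<Longrightarrow> (g, g') \<in> term_equiv \<C> \<Longrightarrow>
     \<C> \<turnstile> f : A \<rightarrow> B \<Longrightarrow> \<C> \<turnstile> g : B \<rightarrow> C \<Longrightarrow> (g \<bullet> f, g' \<bullet> f') \<in> term_equiv \<C>"
| "(f, f') \<in> term_equiv \<C> \<Longrightarrow> (g, g') \<in> term_equiv \<C> \<Longrightarrow> (f \<star> g, f' \<star> g') \<in> term_equiv \<C>"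

section \<open>The free categories\<close>

definition mclass :: "kind \<Rightarrow> 'p mterm \<Rightarrow> 'p mterm set" where
  "mclass \<C> f = term_equiv \<C> `` {f}"

definition free_category :: "kind \<Rightarrow> ('p obj, 'p mterm set) cat_data" where
  "free_category \<C> =
     \<lparr> Ob = UNIV,
       Hom = (\<lambda>A B. {f. \<C> \<turnstile> f : A \<rightarrow> B} // term_equiv \<C>),
       Ident = (\<lambda>A. mclass \<C> (one A)),
       Cmp = (\<lambda>Y X. \<Union>g\<in>Y. \<Union>f\<in>X. mclass \<C> (g \<bullet> f)) \<rparr>"

text \<open>The existence of a map \<open>Fm\<close> on classes with \<open>Fm [f] = [f]\<close> for all terms \<open>f\<close> expresses
  that the assignment is well defined; \<open>Fm\<close> is then determined on the morphisms.\<close>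

definition free_subcategory :: "'p itself \<Rightarrow> kind \<Rightarrow> kind \<Rightarrow> bool" where
  "free_subcategory P \<C> \<D> \<longleftrightarrow>
     (\<exists>Fm :: 'p mterm set \<Rightarrow> 'p mterm set.
        (\<forall>f A B. \<C> \<turnstile> f : A \<rightarrow> B \<longrightarrow> Fm (mclass \<C> f) = mclass \<D> f) \<and>
        category_embedding (free_category \<C>) (free_category \<D>) (\<lambda>A. A) Fm)"

end

theory Submission
  imports Defs
begin

text \<open>
  A morphism-term acts on lists of labels attached to the letter occurrences of its source,
  producing the labels of the letter occurrences of its target. All equations of \<open>Cart\<close> preserve
  this action, so it suffices that terms of \<open>Mon\<close>, \<open>SyMon\<close>, \<open>Rel\<close> and \<open>Aff\<close> of the
  same type with the same action are equal. Every object is isomorphic to a right-bracketed chain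
  of letters, and between chains each admissible list of output labels has a canonical morphism,
  which extracts the output labels one by one, copying a label that is still needed later and
  moving it otherwise. Postcomposing a canonical morphism with the transport of a term \<open>f\<close>
  gives the canonical morphism for the labels rearranged by the action of \<open>f\<close>; hence \<open>f\<close> is
  determined by its action. The argument is uniform in all categories that do not have both
  \<open>w\<close> and \<open>k\<close>.
\<close>

section \<open>Labels carried by morphism-terms\<close>

text \<open>Labels are carried instead of letters because a letter may occur several times in an
  object; distinct labels keep its occurrences apart. The restriction on \<open>w\<close> and
  \<open>k\<close> enters where an identity is multiplied on the right by a term \<open>g\<close>.
  The canonical morphism copies or moves a label of the identity part according to whether that
  label is requested again further on, and applying \<open>g\<close> must not change the answer.
  Without \<open>k\<close>, a term keeps the set of labels; without \<open>w\<close>, no label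
  occurs twice. With both, \<open>g\<close> could delete the last later occurrence of a label and so
  turn a copy into a move, and the equations joining \<open>w\<close> and \<open>k\<close> would be
  called for. \<open>Cart\<close> occurs only as the larger category, where preservation of the
  action is all that is used. Chains and transports carry an arbitrary tail. A right factor of a
  product then becomes part of the tail, and \<open>c\<close>, \<open>w\<close> and \<open>k\<close>
  on letters become moves at the head of a chain.\<close>

fun flat :: "'p obj \<Rightarrow> 'p list" where
  "flat (Letter p) = [p]"
| "flat I = []"
| "flat (A \<otimes> B) = flat A @ flat B"

abbreviation width :: "'p obj \<Rightarrow> nat" where
  "width A \<equiv> length (flat A)"

text \<open>Types are read off from the syntax, for ill-typed terms too, so that typing becomes the
  predicate \<open>typed\<close>, whose recursive clauses can be used as rewrite rules.\<close>

fun tdom :: "'p mterm \<Rightarrow> 'p obj" and tcod :: "'p mterm \<Rightarrow> 'p obj" where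
  "tdom (one A) = A" | "tcod (one A) = A"
| "tdom (\<sigma> A) = I \<otimes> A" | "tcod (\<sigma> A) = A"
| "tdom (\<sigma>i A) = A" | "tcod (\<sigma>i A) = I \<otimes> A"
| "tdom (\<delta> A) = A \<otimes> I" | "tcod (\<delta> A) = A"
| "tdom (\<delta>i A) = A" | "tcod (\<delta>i A) = A \<otimes> I"
| "tdom (br A B C) = A \<otimes> (B \<otimes> C)" | "tcod (br A B C) = (A \<otimes> B) \<otimes> C"
| "tdom (bl A B C) = (A \<otimes> B) \<otimes> C" | "tcod (bl A B C) = A \<otimes> (B \<otimes> C)"
| "tdom (cc A B) = A \<otimes> B" | "tcod (cc A B) = B \<otimes> A"
| "tdom (ww A) = A" | "tcod (ww A) = A \<otimes> A"
| "tdom (kk A) = A" | "tcod (kk A) = I"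
| "tdom (g \<bullet> f) = tdom f" | "tcod (g \<bullet> f) = tcod g"
| "tdom (f \<star> g) = tdom f \<otimes> tdom g" | "tcod (f \<star> g) = tcod f \<otimes> tcod g"

lemma has_type_dom_cod: "\<C> \<turnstile> f : A \<rightarrow> B \<Longrightarrow> tdom f = A \<and> tcod f = B"
  by (induction rule: has_type.induct) auto

definition typed :: "kind \<Rightarrow> 'p mterm \<Rightarrow> bool" where
  "typed \<C> f \<longleftrightarrow> \<C> \<turnstile> f : tdom f \<rightarrow> tcod f"

lemma has_type_iff: "\<C> \<turnstile> f : A \<rightarrow> B \<longleftrightarrow> typed \<C> f \<and> tdom f = A \<and> tcod f = B"
  unfolding typed_def using has_type_dom_cod by blast

lemma typed_simps [simp]:
  "typed \<C> (one A)" "typed \<C> (\<sigma> A)" "typed \<C> (\<sigma>i A)" "typed \<C> (\<delta> A)" "typed \<C> (\<delta>i A)"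
  "typed \<C> (br A B C)" "typed \<C> (bl A B C)"
  "typed \<C> (cc A B) \<longleftrightarrow> has_c \<C>" "typed \<C> (ww A) \<longleftrightarrow> has_w \<C>" "typed \<C> (kk A) \<longleftrightarrow> has_k \<C>"
  "typed \<C> (g \<bullet> f) \<longleftrightarrow> typed \<C> g \<and> typed \<C> f \<and> tdom g = tcod f"
  "typed \<C> (f \<star> g) \<longleftrightarrow> typed \<C> f \<and> typed \<C> g"
  unfolding typed_def
  by (auto intro: has_type.intros elim: has_type.cases dest: has_type_dom_cod)

text \<open>With \<open>l\<close> read as a function on input positions, a typed term precomposes
  \<open>l\<close> with a map from output positions to input positions: a block transposition for
  \<open>cc\<close>, a folding map for \<open>ww\<close>, the empty map for
  \<open>kk\<close>.\<close>

fun act :: "'p mterm \<Rightarrow> 'a list \<Rightarrow> 'a list" where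
  "act (cc A B) l = drop (width A) l @ take (width A) l"
| "act (ww A) l = l @ l"
| "act (kk A) l = []"
| "act (g \<bullet> f) l = act g (act f l)"
| "act (f \<star> g) l = act f (take (width (tdom f)) l) @ act g (drop (width (tdom f)) l)"
| "act (one A) l = l"
| "act (\<sigma> A) l = l" | "act (\<sigma>i A) l = l" | "act (\<delta> A) l = l" | "act (\<delta>i A) l = l"
| "act (br A B C) l = l" | "act (bl A B C) l = l"

lemma length_act: "typed \<C> f \<Longrightarrow> length l = width (tdom f) \<Longrightarrow> length (act f l) = width (tcod f)"
  by (induction f arbitrary: l) auto

text \<open>Typing is part of the invariant, so invariance also yields that equivalent terms are
  well typed with equal source and target. The type argument names the label type, which the terms
  do not determine.\<close>

definition same_act :: "kind \<Rightarrow> 'a itself \<Rightarrow> 'p mterm \<Rightarrow> 'p mterm \<Rightarrow> bool" where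
  "same_act \<C> T f g \<longleftrightarrow> typed \<C> f \<and> typed \<C> g \<and> tdom f = tdom g \<and> tcod f = tcod g \<and>
     (\<forall>l::'a list. length l = width (tdom f) \<longrightarrow> act f l = act g l)"

text \<open>Soundness for every kind, \<open>Cart\<close> included: in \<open>wk_eq\<close>,
  deleting one of the two copies of a list leaves the list.\<close>

lemma equation_same_act:
  assumes "equation \<C> s t" shows "same_act \<C> T s t"
  using assms unfolding equation_def
proof (elim disjE conjE)
  assume "monoidal_eq \<C> s t" then show ?thesis
    by cases (auto simp: same_act_def has_type_iff length_act drop_take add.commute)
next
  assume "c_eq \<C> s t" "has_c \<C>" then show ?thesis
    by cases (auto simp: same_act_def has_type_iff length_act take_add add_ac)
next
  assume "w_eq \<C> s t" "has_w \<C>" moreover have "has_c \<C>" 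
    using \<open>has_w \<C>\<close> by (auto simp: has_w_def has_c_def)
  ultimately show ?thesis
    by cases (auto simp: same_act_def has_type_iff length_act cm_def)
next
  assume "k_eq \<C> s t" "has_k \<C>" then show ?thesis
    by cases (auto simp: same_act_def has_type_iff length_act)
next
  assume "wk_eq s t" "has_w \<C>" "has_k \<C>" then show ?thesis
    by cases (auto simp: same_act_def has_type_iff length_act)
qed

lemma term_equiv_same_act: "(f, g) \<in> term_equiv \<C> \<Longrightarrow> same_act \<C> T f g"
proof (induction rule: term_equiv.induct)
  case (1 s t) then show ?case by (rule equation_same_act)
next
  case (5 f f' g g' A B C)
  then show ?case by (auto simp: same_act_def has_type_iff length_act)
qed (auto simp: same_act_def has_type_iff length_act)

lemma term_equiv_typed:
  assumes "(f, g) \<in> term_equiv \<C>"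
  shows "typed \<C> f" "typed \<C> g" "tdom f = tdom g" "tcod f = tcod g"
  using term_equiv_same_act[OF assms, of "TYPE(nat)"] by (auto simp: same_act_def)

section \<open>Composition and multiplication of classes\<close>

locale free_kind =
  fixes \<C> :: kind
begin

definition cls :: "'p mterm \<Rightarrow> 'p mterm set" ("\<langle>_\<rangle>") where
  "\<langle>f\<rangle> = mclass \<C> f"

text \<open>The class of an ill-typed term is empty, so \<open>{}\<close> is the value of an undefined composite,
  and associativity and interchange hold for arbitrary sets of terms.\<close>

definition comp :: "'p mterm set \<Rightarrow> 'p mterm set \<Rightarrow> 'p mterm set" (infixr "\<odot>" 65) where
  "Y \<odot> X = (\<Union>g\<in>Y. \<Union>f\<in>X. \<langle>g \<bullet> f\<rangle>)"

definition mult :: "'p mterm set \<Rightarrow> 'p mterm set \<Rightarrow> 'p mterm set" (infixr "\<oslash>" 70) where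
  "X \<oslash> Y = (\<Union>f\<in>X. \<Union>g\<in>Y. \<langle>f \<star> g\<rangle>)"

definition ar :: "'p mterm set \<Rightarrow> bool" where
  "ar X \<longleftrightarrow> (\<exists>f. typed \<C> f \<and> X = \<langle>f\<rangle>)"

text \<open>Equivalent terms have the same source, so on the class of a typed term the choice is
  immaterial; on \<open>{}\<close> the value is arbitrary.\<close>

definition dm :: "'p mterm set \<Rightarrow> 'p obj" where "dm X = tdom (SOME f. f \<in> X)"
definition cd :: "'p mterm set \<Rightarrow> 'p obj" where "cd X = tcod (SOME f. f \<in> X)"

lemma mem_cls: "g \<in> \<langle>f\<rangle> \<longleftrightarrow> (f, g) \<in> term_equiv \<C>"
  by (simp add: cls_def mclass_def)

lemma term_equiv_refl: "typed \<C> f \<Longrightarrow> (f, f) \<in> term_equiv \<C>"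
  unfolding typed_def by (rule term_equiv.intros)

lemma cls_self: "typed \<C> f \<Longrightarrow> f \<in> \<langle>f\<rangle>"
  by (simp add: mem_cls term_equiv_refl)

lemma cls_untyped: "\<not> typed \<C> f \<Longrightarrow> \<langle>f\<rangle> = {}"
  by (auto simp: mem_cls dest: term_equiv_typed(1))

lemma cls_eqI: "(f, g) \<in> term_equiv \<C> \<Longrightarrow> \<langle>f\<rangle> = \<langle>g\<rangle>"
  by (intro set_eqI) (meson mem_cls term_equiv.intros(3,4))

lemma cls_eq_iff: "typed \<C> f \<Longrightarrow> \<langle>f\<rangle> = \<langle>g\<rangle> \<longleftrightarrow> (f, g) \<in> term_equiv \<C>"
  by (metis cls_eqI cls_self mem_cls term_equiv.intros(3))

lemma term_equiv_compose:
  assumes "(f, f') \<in> term_equiv \<C>" "(g, g') \<in> term_equiv \<C>" "tdom g = tcod f"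
  shows "(g \<bullet> f, g' \<bullet> f') \<in> term_equiv \<C>"
  using assms(3) term_equiv_typed[OF assms(1)] term_equiv_typed[OF assms(2)]
  by (intro term_equiv.intros(5)[OF assms(1,2), of "tdom f" "tcod f" "tcod g"]) (auto simp: has_type_iff)

text \<open>By congruence all classes in the defining union coincide. Since equivalence preserves
  types, an ill-typed composite has no composable pair of representatives, and both sides are
  empty.\<close>

lemma cls_compose [simp]: "\<langle>g \<bullet> f\<rangle> = \<langle>g\<rangle> \<odot> \<langle>f\<rangle>"
proof (cases "typed \<C> (g \<bullet> f)")
  case True
  have "\<langle>g' \<bullet> f'\<rangle> = \<langle>g \<bullet> f\<rangle>" if "g' \<in> \<langle>g\<rangle>" "f' \<in> \<langle>f\<rangle>" for g' f'
    using that True by (intro cls_eqI[symmetric] term_equiv_compose) (auto simp: mem_cls)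
  then have "\<langle>g\<rangle> \<odot> \<langle>f\<rangle> = (\<Union>g'\<in>\<langle>g\<rangle>. \<Union>f'\<in>\<langle>f\<rangle>. \<langle>g \<bullet> f\<rangle>)"
    unfolding comp_def by (intro SUP_cong refl) blast
  then show ?thesis using True cls_self[of g] cls_self[of f] by auto
next
  case False
  have "\<not> typed \<C> (g' \<bullet> f')" if "g' \<in> \<langle>g\<rangle>" "f' \<in> \<langle>f\<rangle>" for g' f'
    using that[unfolded mem_cls, THEN term_equiv_typed(1)] that[unfolded mem_cls, THEN term_equiv_typed(3)]
      that[unfolded mem_cls, THEN term_equiv_typed(4)] False by auto
  then have "\<langle>g\<rangle> \<odot> \<langle>f\<rangle> = {}" unfolding comp_def using cls_untyped by blast
  then show ?thesis using cls_untyped[OF False] by simp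
qed

lemma cls_multiply [simp]: "\<langle>f \<star> g\<rangle> = \<langle>f\<rangle> \<oslash> \<langle>g\<rangle>"
proof (cases "typed \<C> (f \<star> g)")
  case True
  have "\<langle>f' \<star> g'\<rangle> = \<langle>f \<star> g\<rangle>" if "g' \<in> \<langle>g\<rangle>" "f' \<in> \<langle>f\<rangle>" for g' f'
    using that True by (intro cls_eqI[symmetric] term_equiv.intros(6)) (auto simp: mem_cls)
  then have "\<langle>f\<rangle> \<oslash> \<langle>g\<rangle> = (\<Union>f'\<in>\<langle>f\<rangle>. \<Union>g'\<in>\<langle>g\<rangle>. \<langle>f \<star> g\<rangle>)"
    unfolding mult_def by (intro SUP_cong refl) blast
  then show ?thesis using True cls_self[of g] cls_self[of f] by auto
next
  case False
  have "\<not> typed \<C> (f' \<star> g')" if "g' \<in> \<langle>g\<rangle>" "f' \<in> \<langle>f\<rangle>" for g' f'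
    using that[unfolded mem_cls, THEN term_equiv_typed(1)] False by auto
  then have "\<langle>f\<rangle> \<oslash> \<langle>g\<rangle> = {}" unfolding mult_def using cls_untyped by blast
  then show ?thesis using cls_untyped[OF False] by simp
qed

lemma dm_cls: "typed \<C> f \<Longrightarrow> dm \<langle>f\<rangle> = tdom f" and cd_cls: "typed \<C> f \<Longrightarrow> cd \<langle>f\<rangle> = tcod f"
proof -
  assume "typed \<C> f"
  then have "(f, SOME g. g \<in> \<langle>f\<rangle>) \<in> term_equiv \<C>"
    using someI[of "\<lambda>g. g \<in> \<langle>f\<rangle>", OF cls_self] by (simp add: mem_cls)
  from term_equiv_typed(3,4)[OF this]
  show "dm \<langle>f\<rangle> = tdom f" "cd \<langle>f\<rangle> = tcod f"
    by (simp_all add: dm_def cd_def)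
qed

lemma ar_cls: "typed \<C> f \<Longrightarrow> ar \<langle>f\<rangle>"
  by (auto simp: ar_def)

lemma arE:
  assumes "ar X" obtains f where "typed \<C> f" "X = \<langle>f\<rangle>" "dm X = tdom f" "cd X = tcod f"
  using assms by (auto simp: ar_def dm_cls cd_cls)

lemma ar_gen [simp]:
  "ar \<langle>one A\<rangle>" "ar \<langle>\<sigma> A\<rangle>" "ar \<langle>\<sigma>i A\<rangle>" "ar \<langle>\<delta> A\<rangle>" "ar \<langle>\<delta>i A\<rangle>" "ar \<langle>br A B C\<rangle>" "ar \<langle>bl A B C\<rangle>"
  "has_c \<C> \<Longrightarrow> ar \<langle>cc A B\<rangle>" "has_w \<C> \<Longrightarrow> ar \<langle>ww A\<rangle>" "has_k \<C> \<Longrightarrow> ar \<langle>kk A\<rangle>"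
  by (auto intro: ar_cls)

lemma dm_gen [simp]:
  "dm \<langle>one A\<rangle> = A" "dm \<langle>\<sigma> A\<rangle> = I \<otimes> A" "dm \<langle>\<sigma>i A\<rangle> = A" "dm \<langle>\<delta> A\<rangle> = A \<otimes> I" "dm \<langle>\<delta>i A\<rangle> = A"
  "dm \<langle>br A B C\<rangle> = A \<otimes> (B \<otimes> C)" "dm \<langle>bl A B C\<rangle> = (A \<otimes> B) \<otimes> C"
  "has_c \<C> \<Longrightarrow> dm \<langle>cc A B\<rangle> = A \<otimes> B" "has_w \<C> \<Longrightarrow> dm \<langle>ww A\<rangle> = A" "has_k \<C> \<Longrightarrow> dm \<langle>kk A\<rangle> = A"
  by (auto simp: dm_cls)

lemma cd_gen [simp]:
  "cd \<langle>one A\<rangle> = A" "cd \<langle>\<sigma> A\<rangle> = A" "cd \<langle>\<sigma>i A\<rangle> = I \<otimes> A" "cd \<langle>\<delta> A\<rangle> = A" "cd \<langle>\<delta>i A\<rangle> = A \<otimes> I"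
  "cd \<langle>br A B C\<rangle> = (A \<otimes> B) \<otimes> C" "cd \<langle>bl A B C\<rangle> = A \<otimes> (B \<otimes> C)"
  "has_c \<C> \<Longrightarrow> cd \<langle>cc A B\<rangle> = B \<otimes> A" "has_w \<C> \<Longrightarrow> cd \<langle>ww A\<rangle> = A \<otimes> A" "has_k \<C> \<Longrightarrow> cd \<langle>kk A\<rangle> = I"
  by (auto simp: cd_cls)

lemma
  assumes "ar X" "ar Y" "dm Y = cd X"
  shows ar_comp [simp]: "ar (Y \<odot> X)" and dm_comp [simp]: "dm (Y \<odot> X) = dm X"
    and cd_comp [simp]: "cd (Y \<odot> X) = cd Y"
proof -
  obtain f g where f: "typed \<C> f" "X = \<langle>f\<rangle>" "dm X = tdom f" "cd X = tcod f"
    and g: "typed \<C> g" "Y = \<langle>g\<rangle>" "dm Y = tdom g" "cd Y = tcod g"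
    using assms arE by metis
  then have "Y \<odot> X = \<langle>g \<bullet> f\<rangle>" "typed \<C> (g \<bullet> f)" using assms by auto
  then show "ar (Y \<odot> X)" "dm (Y \<odot> X) = dm X" "cd (Y \<odot> X) = cd Y"
    using ar_cls[of "g \<bullet> f"] dm_cls[of "g \<bullet> f"] cd_cls[of "g \<bullet> f"] f g by simp_all
qed

lemma
  assumes "ar X" "ar Y"
  shows ar_mult [simp]: "ar (X \<oslash> Y)" and dm_mult [simp]: "dm (X \<oslash> Y) = dm X \<otimes> dm Y"
    and cd_mult [simp]: "cd (X \<oslash> Y) = cd X \<otimes> cd Y"
proof -
  obtain f g where f: "typed \<C> f" "X = \<langle>f\<rangle>" "dm X = tdom f" "cd X = tcod f"
    and g: "typed \<C> g" "Y = \<langle>g\<rangle>" "dm Y = tdom g" "cd Y = tcod g"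
    using assms arE by metis
  then have "X \<oslash> Y = \<langle>f \<star> g\<rangle>" "typed \<C> (f \<star> g)" using assms by auto
  then show "ar (X \<oslash> Y)" "dm (X \<oslash> Y) = dm X \<otimes> dm Y" "cd (X \<oslash> Y) = cd X \<otimes> cd Y"
    using ar_cls[of "f \<star> g"] dm_cls[of "f \<star> g"] cd_cls[of "f \<star> g"] f g by simp_all
qed

lemma comp_UN: "Y \<odot> X = (\<Union>g\<in>Y. \<Union>f\<in>X. \<langle>g\<rangle> \<odot> \<langle>f\<rangle>)"
  unfolding comp_def[of Y X] by (simp only: cls_compose)

lemma mult_UN: "X \<oslash> Y = (\<Union>f\<in>X. \<Union>g\<in>Y. \<langle>f\<rangle> \<oslash> \<langle>g\<rangle>)"
  unfolding mult_def[of X Y] by (simp only: cls_multiply)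

lemma comp_UN_left: "(\<Union>i\<in>J. F i) \<odot> X = (\<Union>i\<in>J. F i \<odot> X)"
  and comp_UN_right: "Y \<odot> (\<Union>i\<in>J. F i) = (\<Union>i\<in>J. Y \<odot> F i)"
  and mult_UN_left: "(\<Union>i\<in>J. F i) \<oslash> X = (\<Union>i\<in>J. F i \<oslash> X)"
  and mult_UN_right: "Y \<oslash> (\<Union>i\<in>J. F i) = (\<Union>i\<in>J. Y \<oslash> F i)"
  unfolding comp_def mult_def by blast+

lemma comp_assoc_cls: "(\<langle>h\<rangle> \<odot> \<langle>g\<rangle>) \<odot> \<langle>f\<rangle> = \<langle>h\<rangle> \<odot> (\<langle>g\<rangle> \<odot> \<langle>f\<rangle>)"
proof (cases "typed \<C> (h \<bullet> (g \<bullet> f))")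
  case True
  then have "\<langle>h \<bullet> (g \<bullet> f)\<rangle> = \<langle>(h \<bullet> g) \<bullet> f\<rangle>"
    by (intro cls_eqI term_equiv.intros(1))
      (auto simp: equation_def has_type_iff intro!: monoidal_eq.intros(3))
  then show ?thesis by simp
next
  case False
  then show ?thesis using cls_untyped[of "h \<bullet> (g \<bullet> f)"] cls_untyped[of "(h \<bullet> g) \<bullet> f"] by auto
qed

text \<open>All members of a class have that same class, so the union over representatives of
  \<open>t\<close> is constant; only an empty class has to be treated apart.\<close>

lemma comp_cls_left: "\<langle>t\<rangle> \<odot> X = (\<Union>f\<in>X. \<langle>t\<rangle> \<odot> \<langle>f\<rangle>)"
  and comp_cls_right: "X \<odot> \<langle>t\<rangle> = (\<Union>f\<in>X. \<langle>f\<rangle> \<odot> \<langle>t\<rangle>)"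
proof -
  have t: "\<langle>u\<rangle> = \<langle>t\<rangle>" if "u \<in> \<langle>t\<rangle>" for u
    using that cls_eqI mem_cls by metis
  have *: "\<langle>t\<rangle> \<odot> X = (\<Union>u\<in>\<langle>t\<rangle>. \<Union>f\<in>X. \<langle>t\<rangle> \<odot> \<langle>f\<rangle>)" "X \<odot> \<langle>t\<rangle> = (\<Union>f\<in>X. \<Union>u\<in>\<langle>t\<rangle>. \<langle>f\<rangle> \<odot> \<langle>t\<rangle>)"
    unfolding comp_UN[of "\<langle>t\<rangle>" X] comp_UN[of X "\<langle>t\<rangle>"]
    by (intro SUP_cong refl, simp only: t)+
  have e: "{} \<odot> Y = {}" "Y \<odot> {} = {}" for Y :: "'p mterm set"
    unfolding comp_def by simp_all
  show "\<langle>t\<rangle> \<odot> X = (\<Union>f\<in>X. \<langle>t\<rangle> \<odot> \<langle>f\<rangle>)"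
    by (cases "\<langle>t\<rangle> = {}", simp only: e UN_empty2, rule trans[OF *(1)], simp only: UN_constant if_False)
  show "X \<odot> \<langle>t\<rangle> = (\<Union>f\<in>X. \<langle>f\<rangle> \<odot> \<langle>t\<rangle>)"
    by (cases "\<langle>t\<rangle> = {}", simp only: e UN_empty2, rule trans[OF *(2)], simp only: UN_constant if_False)
qed

text \<open>Both sides are unions over representatives of the three factors, which reduces the claim
  to classes. Free of typing premises, it can serve as an unconditional rewrite rule.\<close>

lemma comp_assoc [simp]: "(h \<odot> g) \<odot> f = h \<odot> (g \<odot> f)"
proof -
  have "(h \<odot> g) \<odot> f = (\<Union>h'\<in>h. \<Union>g'\<in>g. \<Union>f'\<in>f. (\<langle>h'\<rangle> \<odot> \<langle>g'\<rangle>) \<odot> \<langle>f'\<rangle>)"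
    unfolding comp_def[of h g] comp_UN_left comp_cls_left[of _ f] by (simp only: cls_compose)
  also have "\<dots> = (\<Union>h'\<in>h. \<Union>g'\<in>g. \<Union>f'\<in>f. \<langle>h'\<rangle> \<odot> (\<langle>g'\<rangle> \<odot> \<langle>f'\<rangle>))"
    by (simp only: comp_assoc_cls)
  also have "\<dots> = (\<Union>g'\<in>g. \<Union>f'\<in>f. \<Union>h'\<in>h. \<langle>h'\<rangle> \<odot> (\<langle>g'\<rangle> \<odot> \<langle>f'\<rangle>))"
    by blast
  also have "\<dots> = h \<odot> (g \<odot> f)"
    unfolding comp_def[of g f] comp_UN_right comp_cls_right[of h "_ \<bullet> _"] by (simp only: cls_compose)
  finally show ?thesis .
qed

lemma interchange_cls:
  "(\<langle>g1\<rangle> \<odot> \<langle>f1\<rangle>) \<oslash> (\<langle>g2\<rangle> \<odot> \<langle>f2\<rangle>) = (\<langle>g1\<rangle> \<oslash> \<langle>g2\<rangle>) \<odot> (\<langle>f1\<rangle> \<oslash> \<langle>f2\<rangle>)"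
proof (cases "typed \<C> ((g1 \<bullet> f1) \<star> (g2 \<bullet> f2))")
  case True
  then have "\<langle>(g1 \<bullet> f1) \<star> (g2 \<bullet> f2)\<rangle> = \<langle>(g1 \<star> g2) \<bullet> (f1 \<star> f2)\<rangle>"
    by (intro cls_eqI term_equiv.intros(1))
      (auto simp: equation_def has_type_iff intro!: monoidal_eq.intros(4))
  then show ?thesis by simp
next
  case False
  then show ?thesis
    using cls_untyped[of "(g1 \<bullet> f1) \<star> (g2 \<bullet> f2)"] cls_untyped[of "(g1 \<star> g2) \<bullet> (f1 \<star> f2)"] by auto
qed

lemma interchange: "(g1 \<oslash> g2) \<odot> (f1 \<oslash> f2) = (g1 \<odot> f1) \<oslash> (g2 \<odot> f2)"
proof -
  have "(g1 \<odot> f1) \<oslash> (g2 \<odot> f2) = (\<Union>u1\<in>g1. \<Union>v1\<in>f1. \<Union>u2\<in>g2. \<Union>v2\<in>f2.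
      (\<langle>u1\<rangle> \<odot> \<langle>v1\<rangle>) \<oslash> (\<langle>u2\<rangle> \<odot> \<langle>v2\<rangle>))"
    unfolding comp_def[of g1 f1] comp_def[of g2 f2] mult_UN_left mult_UN_right
    unfolding cls_multiply[symmetric] by (simp only: cls_compose cls_multiply) blast
  also have "\<dots> = (\<Union>u1\<in>g1. \<Union>v1\<in>f1. \<Union>u2\<in>g2. \<Union>v2\<in>f2.
      (\<langle>u1\<rangle> \<oslash> \<langle>u2\<rangle>) \<odot> (\<langle>v1\<rangle> \<oslash> \<langle>v2\<rangle>))"
    by (simp only: interchange_cls)
  also have "\<dots> = (\<Union>u1\<in>g1. \<Union>u2\<in>g2. \<Union>v1\<in>f1. \<Union>v2\<in>f2.
      (\<langle>u1\<rangle> \<oslash> \<langle>u2\<rangle>) \<odot> (\<langle>v1\<rangle> \<oslash> \<langle>v2\<rangle>))"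
    by blast
  also have "\<dots> = (g1 \<oslash> g2) \<odot> (f1 \<oslash> f2)"
    unfolding mult_UN[of g1] mult_UN[of f1] comp_UN_left comp_UN_right by blast
  finally show ?thesis by simp
qed

lemma interchange': "(g1 \<oslash> g2) \<odot> ((f1 \<oslash> f2) \<odot> r) = ((g1 \<odot> f1) \<oslash> (g2 \<odot> f2)) \<odot> r"
  by (simp only: comp_assoc[symmetric] interchange)

section \<open>The defining equations as equations between classes\<close>

lemma
  shows monoidal: "monoidal_eq \<C> s t \<Longrightarrow> \<langle>s\<rangle> = \<langle>t\<rangle>"
    and symmetry: "has_c \<C> \<Longrightarrow> c_eq \<C> s t \<Longrightarrow> \<langle>s\<rangle> = \<langle>t\<rangle>"
    and contraction: "has_w \<C> \<Longrightarrow> w_eq \<C> s t \<Longrightarrow> \<langle>s\<rangle> = \<langle>t\<rangle>"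
    and discarding: "has_k \<C> \<Longrightarrow> k_eq \<C> s t \<Longrightarrow> \<langle>s\<rangle> = \<langle>t\<rangle>"
  by (auto intro!: cls_eqI term_equiv.intros(1) simp: equation_def)

lemma comp_one [simp]: assumes "ar f" "dm f = A" shows "f \<odot> \<langle>one A\<rangle> = f"
proof -
  obtain t where "typed \<C> t" "f = \<langle>t\<rangle>" "tdom t = A" using assms arE by metis
  then show ?thesis using monoidal[OF monoidal_eq.intros(1), of t A] by (simp add: has_type_iff)
qed

lemma one_comp [simp]: assumes "ar f" "cd f = A" shows "\<langle>one A\<rangle> \<odot> f = f"
proof -
  obtain t where "typed \<C> t" "f = \<langle>t\<rangle>" "tcod t = A" using assms arE by metis
  then show ?thesis using monoidal[OF monoidal_eq.intros(2), of t _ A] by (simp add: has_type_iff)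
qed

lemma one_comp' [simp]: "ar f \<Longrightarrow> cd f = A \<Longrightarrow> \<langle>one A\<rangle> \<odot> (f \<odot> r) = f \<odot> r"
  by (metis comp_assoc one_comp)

lemma one_mult_one [simp]: "\<langle>one A\<rangle> \<oslash> \<langle>one B\<rangle> = \<langle>one (A \<otimes> B)\<rangle>"
  using monoidal[OF monoidal_eq.intros(5)] by simp

lemma nat_\<sigma>: assumes "ar f" shows "f \<odot> \<langle>\<sigma> (dm f)\<rangle> = \<langle>\<sigma> (cd f)\<rangle> \<odot> (\<langle>one I\<rangle> \<oslash> f)"
proof -
  obtain t0 where t0: "typed \<C> t0" "f = \<langle>t0\<rangle>" "dm f = tdom t0" "cd f = tcod t0"
    using assms arE by metis
  show ?thesis using assms t0 monoidal[OF monoidal_eq.intros(6), of t0 "tdom t0" "tcod t0"] by (simp add: has_type_iff)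
qed

lemma nat_\<delta>: assumes "ar f" shows "f \<odot> \<langle>\<delta> (dm f)\<rangle> = \<langle>\<delta> (cd f)\<rangle> \<odot> (f \<oslash> \<langle>one I\<rangle>)"
proof -
  obtain t0 where t0: "typed \<C> t0" "f = \<langle>t0\<rangle>" "dm f = tdom t0" "cd f = tcod t0"
    using assms arE by metis
  show ?thesis using assms t0 monoidal[OF monoidal_eq.intros(7), of t0 "tdom t0" "tcod t0"] by (simp add: has_type_iff)
qed

lemma \<sigma>_inverse [simp]: "\<langle>\<sigma> A\<rangle> \<odot> \<langle>\<sigma>i A\<rangle> = \<langle>one A\<rangle>" "\<langle>\<sigma>i A\<rangle> \<odot> \<langle>\<sigma> A\<rangle> = \<langle>one (I \<otimes> A)\<rangle>"
  using monoidal[OF monoidal_eq.intros(8)] monoidal[OF monoidal_eq.intros(9)] by simp_all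

lemma \<delta>_inverse [simp]: "\<langle>\<delta> A\<rangle> \<odot> \<langle>\<delta>i A\<rangle> = \<langle>one A\<rangle>" "\<langle>\<delta>i A\<rangle> \<odot> \<langle>\<delta> A\<rangle> = \<langle>one (A \<otimes> I)\<rangle>"
  using monoidal[OF monoidal_eq.intros(10)] monoidal[OF monoidal_eq.intros(11)] by simp_all

lemma nat_br:
  assumes "ar f" "ar g" "ar h"
  shows "((f \<oslash> g) \<oslash> h) \<odot> \<langle>br (dm f) (dm g) (dm h)\<rangle> = \<langle>br (cd f) (cd g) (cd h)\<rangle> \<odot> (f \<oslash> (g \<oslash> h))"
proof -
  obtain t0 where t0: "typed \<C> t0" "f = \<langle>t0\<rangle>" "dm f = tdom t0" "cd f = tcod t0"
    using assms arE by metis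
  obtain t1 where t1: "typed \<C> t1" "g = \<langle>t1\<rangle>" "dm g = tdom t1" "cd g = tcod t1"
    using assms arE by metis
  obtain t2 where t2: "typed \<C> t2" "h = \<langle>t2\<rangle>" "dm h = tdom t2" "cd h = tcod t2"
    using assms arE by metis
  show ?thesis using assms t0 t1 t2 monoidal[OF monoidal_eq.intros(13), of t0 "tdom t0" "tcod t0" t1 "tdom t1" "tcod t1" t2 "tdom t2" "tcod t2"] by (simp add: has_type_iff)
qed

lemma b_inverse [simp]:
  "\<langle>br A B C\<rangle> \<odot> \<langle>bl A B C\<rangle> = \<langle>one ((A \<otimes> B) \<otimes> C)\<rangle>" "\<langle>bl A B C\<rangle> \<odot> \<langle>br A B C\<rangle> = \<langle>one (A \<otimes> (B \<otimes> C))\<rangle>"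
  using monoidal[OF monoidal_eq.intros(14)] monoidal[OF monoidal_eq.intros(15)] by simp_all

lemma triangle: "(\<langle>\<delta> A\<rangle> \<oslash> \<langle>one B\<rangle>) \<odot> \<langle>br A I B\<rangle> = \<langle>one A\<rangle> \<oslash> \<langle>\<sigma> B\<rangle>"
  using monoidal[OF monoidal_eq.intros(16)] by simp

lemma pentagon: "\<langle>br (A \<otimes> B) C D\<rangle> \<odot> \<langle>br A B (C \<otimes> D)\<rangle> =
    (\<langle>br A B C\<rangle> \<oslash> \<langle>one D\<rangle>) \<odot> (\<langle>br A (B \<otimes> C) D\<rangle> \<odot> (\<langle>one A\<rangle> \<oslash> \<langle>br B C D\<rangle>))"
  using monoidal[OF monoidal_eq.intros(17)] by simp

lemma nat_c:
  assumes "has_c \<C>" "ar f" "ar g"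
  shows "(g \<oslash> f) \<odot> \<langle>cc (dm f) (dm g)\<rangle> = \<langle>cc (cd f) (cd g)\<rangle> \<odot> (f \<oslash> g)"
proof -
  obtain t0 where t0: "typed \<C> t0" "f = \<langle>t0\<rangle>" "dm f = tdom t0" "cd f = tcod t0"
    using assms arE by metis
  obtain t1 where t1: "typed \<C> t1" "g = \<langle>t1\<rangle>" "dm g = tdom t1" "cd g = tcod t1"
    using assms arE by metis
  show ?thesis using assms t0 t1 symmetry[OF _ c_eq.intros(1), of t0 "tdom t0" "tcod t0" t1 "tdom t1" "tcod t1"] by (simp add: has_type_iff)
qed

lemma c_inverse [simp]: "has_c \<C> \<Longrightarrow> \<langle>cc B A\<rangle> \<odot> \<langle>cc A B\<rangle> = \<langle>one (A \<otimes> B)\<rangle>"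
  using symmetry[OF _ c_eq.intros(2)] by simp

lemma \<sigma>_c: "has_c \<C> \<Longrightarrow> \<langle>\<sigma> A\<rangle> \<odot> \<langle>cc A I\<rangle> = \<langle>\<delta> A\<rangle>"
  using symmetry[OF _ c_eq.intros(3)] by simp

lemma hexagon: "has_c \<C> \<Longrightarrow> \<langle>br C A B\<rangle> \<odot> (\<langle>cc (A \<otimes> B) C\<rangle> \<odot> \<langle>br A B C\<rangle>) =
    (\<langle>cc A C\<rangle> \<oslash> \<langle>one B\<rangle>) \<odot> (\<langle>br A C B\<rangle> \<odot> (\<langle>one A\<rangle> \<oslash> \<langle>cc B C\<rangle>))"
  using symmetry[OF _ c_eq.intros(4)] by simp

lemma \<sigma>_w: "has_w \<C> \<Longrightarrow> \<langle>\<sigma> I\<rangle> \<odot> \<langle>ww I\<rangle> = \<langle>one I\<rangle>"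
  using contraction[OF _ w_eq.intros(2)] by simp

lemma w_assoc: "has_w \<C> \<Longrightarrow> \<langle>br A A A\<rangle> \<odot> ((\<langle>one A\<rangle> \<oslash> \<langle>ww A\<rangle>) \<odot> \<langle>ww A\<rangle>) = (\<langle>ww A\<rangle> \<oslash> \<langle>one A\<rangle>) \<odot> \<langle>ww A\<rangle>"
  using contraction[OF _ w_eq.intros(3)] by simp

lemma c_w: "has_w \<C> \<Longrightarrow> \<langle>cc A A\<rangle> \<odot> \<langle>ww A\<rangle> = \<langle>ww A\<rangle>"
  using contraction[OF _ w_eq.intros(4)] by simp

lemma cm_w: "has_w \<C> \<Longrightarrow> \<langle>cm A B A B\<rangle> \<odot> \<langle>ww (A \<otimes> B)\<rangle> = \<langle>ww A\<rangle> \<oslash> \<langle>ww B\<rangle>"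
  using contraction[OF _ w_eq.intros(5)] by simp

lemma nat_k: assumes "has_k \<C>" "ar f" shows "\<langle>kk (cd f)\<rangle> \<odot> f = \<langle>kk (dm f)\<rangle>"
proof -
  obtain t0 where t0: "typed \<C> t0" "f = \<langle>t0\<rangle>" "dm f = tdom t0" "cd f = tcod t0"
    using assms arE by metis
  show ?thesis using assms t0 discarding[OF _ k_eq.intros(1), of t0 "tdom t0" "tcod t0"] by (simp add: has_type_iff)
qed

lemma k_I: "has_k \<C> \<Longrightarrow> \<langle>kk I\<rangle> = \<langle>one I\<rangle>"
  using discarding[OF _ k_eq.intros(2)] by simp

end

section \<open>Exchange, duplication and deletion of the head of a chain\<close>

context free_kind
begin

text \<open>Composites are kept nested to the right; this makes an equation about two adjacent
  factors applicable in the middle of a longer composite.\<close>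

lemma comp_rest: "f \<odot> g = h \<Longrightarrow> f \<odot> (g \<odot> r) = h \<odot> r"
  by (metis comp_assoc)

lemma comp_rest3: "f \<odot> (g \<odot> h) = k \<Longrightarrow> f \<odot> (g \<odot> (h \<odot> r)) = k \<odot> r"
  by (metis comp_assoc)

lemma cancel_left:
  assumes "i \<odot> m = \<langle>one A\<rangle>" "m \<odot> f = m \<odot> g" "ar f" "ar g" "cd f = A" "cd g = A"
  shows "f = g"
  by (metis assms comp_assoc one_comp)

lemma cancel_right:
  assumes "m \<odot> i = \<langle>one A\<rangle>" "f \<odot> m = g \<odot> m" "ar f" "ar g" "dm f = A" "dm g = A"
  shows "f = g"
  by (metis assms comp_assoc comp_one)

lemmas inverse_rest [simp] = \<sigma>_inverse[THEN comp_rest] \<delta>_inverse[THEN comp_rest] b_inverse[THEN comp_rest]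

lemma c_inverse_rest [simp]: "has_c \<C> \<Longrightarrow> \<langle>cc B A\<rangle> \<odot> (\<langle>cc A B\<rangle> \<odot> r) = \<langle>one (A \<otimes> B)\<rangle> \<odot> r"
  by (rule comp_rest) simp

section \<open>Consequences of the monoidal equations\<close>

lemma nat_bl:
  assumes "ar f" "ar g" "ar h"
  shows "\<langle>bl (cd f) (cd g) (cd h)\<rangle> \<odot> ((f \<oslash> g) \<oslash> h) = (f \<oslash> (g \<oslash> h)) \<odot> \<langle>bl (dm f) (dm g) (dm h)\<rangle>"
proof -
  have "\<langle>bl (cd f) (cd g) (cd h)\<rangle> \<odot> ((f \<oslash> g) \<oslash> h)
      = \<langle>bl (cd f) (cd g) (cd h)\<rangle> \<odot> (((f \<oslash> g) \<oslash> h) \<odot> \<langle>br (dm f) (dm g) (dm h)\<rangle>) \<odot> \<langle>bl (dm f) (dm g) (dm h)\<rangle>"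
    using assms by simp
  also have "\<dots> = (f \<oslash> (g \<oslash> h)) \<odot> \<langle>bl (dm f) (dm g) (dm h)\<rangle>"
    unfolding nat_br[OF assms] using assms by simp
  finally show ?thesis .
qed

lemma bl_br_conj:
  assumes "ar f" "ar g" "ar h" "dm f = A" "dm g = B" "dm h = C" "cd f = A'" "cd g = B'" "cd h = C'"
  shows "\<langle>bl A' B' C'\<rangle> \<odot> (((f \<oslash> g) \<oslash> h) \<odot> \<langle>br A B C\<rangle>) = f \<oslash> (g \<oslash> h)"
  using nat_br[OF assms(1-3)] assms by simp

text \<open>The pentagon with all arrows inverted: both sides are left inverse to the isomorphism
  \<open>?P\<close>, which can be cancelled.\<close>

lemma pentagon_bl: "\<langle>bl A B (C \<otimes> D)\<rangle> \<odot> \<langle>bl (A \<otimes> B) C D\<rangle> =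
    (\<langle>one A\<rangle> \<oslash> \<langle>bl B C D\<rangle>) \<odot> (\<langle>bl A (B \<otimes> C) D\<rangle> \<odot> (\<langle>bl A B C\<rangle> \<oslash> \<langle>one D\<rangle>))"
proof (rule cancel_right)
  let ?P = "\<langle>br (A \<otimes> B) C D\<rangle> \<odot> \<langle>br A B (C \<otimes> D)\<rangle>"
  let ?Q = "\<langle>bl A B (C \<otimes> D)\<rangle> \<odot> \<langle>bl (A \<otimes> B) C D\<rangle>"
  show "?P \<odot> ?Q = \<langle>one (((A \<otimes> B) \<otimes> C) \<otimes> D)\<rangle>" by simp
  have "((\<langle>one A\<rangle> \<oslash> \<langle>bl B C D\<rangle>) \<odot> (\<langle>bl A (B \<otimes> C) D\<rangle> \<odot> (\<langle>bl A B C\<rangle> \<oslash> \<langle>one D\<rangle>))) \<odot> ?P = \<langle>one (A \<otimes> (B \<otimes> (C \<otimes> D)))\<rangle>"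
    unfolding pentagon by (simp add: interchange interchange')
  then show "?Q \<odot> ?P = ((\<langle>one A\<rangle> \<oslash> \<langle>bl B C D\<rangle>) \<odot> (\<langle>bl A (B \<otimes> C) D\<rangle> \<odot> (\<langle>bl A B C\<rangle> \<oslash> \<langle>one D\<rangle>))) \<odot> ?P"
    by simp
qed simp_all

text \<open>Kelly's derivation of a second unit triangle from the given one. The pentagon with two
  unit factors proves the equation multiplied on the left by the identity of \<open>I\<close>;
  naturality of \<sigma> strips that factor off.\<close>

lemma \<sigma>_br: "(\<langle>\<sigma> A\<rangle> \<oslash> \<langle>one X\<rangle>) \<odot> \<langle>br I A X\<rangle> = \<langle>\<sigma> (A \<otimes> X)\<rangle>"
proof -
  let ?f = "(\<langle>\<sigma> A\<rangle> \<oslash> \<langle>one X\<rangle>) \<odot> \<langle>br I A X\<rangle>"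
  let ?d = "(\<langle>\<delta> I\<rangle> \<oslash> \<langle>one A\<rangle>) \<oslash> \<langle>one X\<rangle>"
  have "\<langle>br I A X\<rangle> \<odot> (\<langle>one I\<rangle> \<oslash> \<langle>\<sigma> (A \<otimes> X)\<rangle>) = \<langle>br I A X\<rangle> \<odot> ((\<langle>\<delta> I\<rangle> \<oslash> \<langle>one (A \<otimes> X)\<rangle>) \<odot> \<langle>br I I (A \<otimes> X)\<rangle>)"
    by (simp only: triangle)
  also have "\<dots> = ?d \<odot> (\<langle>br (I \<otimes> I) A X\<rangle> \<odot> \<langle>br I I (A \<otimes> X)\<rangle>)"
    using nat_br[of "\<langle>\<delta> I\<rangle>" "\<langle>one A\<rangle>" "\<langle>one X\<rangle>", THEN comp_rest] by simp
  also have "\<dots> = ((\<langle>one I\<rangle> \<oslash> \<langle>\<sigma> A\<rangle>) \<oslash> \<langle>one X\<rangle>) \<odot> (\<langle>br I (I \<otimes> A) X\<rangle> \<odot> (\<langle>one I\<rangle> \<oslash> \<langle>br I A X\<rangle>))"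
    unfolding pentagon by (simp add: interchange' triangle)
  also have "\<dots> = \<langle>br I A X\<rangle> \<odot> ((\<langle>one I\<rangle> \<oslash> (\<langle>\<sigma> A\<rangle> \<oslash> \<langle>one X\<rangle>)) \<odot> (\<langle>one I\<rangle> \<oslash> \<langle>br I A X\<rangle>))"
    using nat_br[of "\<langle>one I\<rangle>" "\<langle>\<sigma> A\<rangle>" "\<langle>one X\<rangle>", THEN comp_rest] by simp
  also have "\<dots> = \<langle>br I A X\<rangle> \<odot> (\<langle>one I\<rangle> \<oslash> ?f)"
    by (simp add: interchange)
  finally have "\<langle>one I\<rangle> \<oslash> \<langle>\<sigma> (A \<otimes> X)\<rangle> = \<langle>one I\<rangle> \<oslash> ?f"
    by (rule cancel_left[OF b_inverse(2)]) simp_all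
  then have "\<langle>\<sigma> (A \<otimes> X)\<rangle> \<odot> \<langle>\<sigma> (I \<otimes> (A \<otimes> X))\<rangle> = ?f \<odot> \<langle>\<sigma> (I \<otimes> (A \<otimes> X))\<rangle>"
    using nat_\<sigma>[of "\<langle>\<sigma> (A \<otimes> X)\<rangle>"] nat_\<sigma>[of ?f] by simp
  then show ?thesis
    using cancel_right[of "\<langle>\<sigma> (I \<otimes> (A \<otimes> X))\<rangle>" "\<langle>\<sigma>i (I \<otimes> (A \<otimes> X))\<rangle>" "I \<otimes> (A \<otimes> X)"] by simp
qed

lemma \<sigma>_bl: "\<langle>\<sigma> (A \<otimes> X)\<rangle> \<odot> \<langle>bl I A X\<rangle> = \<langle>\<sigma> A\<rangle> \<oslash> \<langle>one X\<rangle>"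
  by (simp flip: \<sigma>_br)

lemma \<delta>_bl: "(\<langle>one A\<rangle> \<oslash> \<langle>\<sigma> X\<rangle>) \<odot> \<langle>bl A I X\<rangle> = \<langle>\<delta> A\<rangle> \<oslash> \<langle>one X\<rangle>"
  by (simp flip: triangle)

text \<open>The moves \<open>sw\<close>, \<open>dup\<close> and \<open>del\<close> act at the head
  of a right-nested product with tail \<open>X\<close>; they absorb all rebracketing, so that none
  is visible in the canonical morphisms.\<close>

definition sw :: "'p obj \<Rightarrow> 'p obj \<Rightarrow> 'p obj \<Rightarrow> 'p mterm set" where
  "sw A B X = \<langle>bl B A X\<rangle> \<odot> ((\<langle>cc A B\<rangle> \<oslash> \<langle>one X\<rangle>) \<odot> \<langle>br A B X\<rangle>)"

definition dup :: "'p obj \<Rightarrow> 'p obj \<Rightarrow> 'p mterm set" where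
  "dup A X = \<langle>bl A A X\<rangle> \<odot> (\<langle>ww A\<rangle> \<oslash> \<langle>one X\<rangle>)"

definition del :: "'p obj \<Rightarrow> 'p obj \<Rightarrow> 'p mterm set" where
  "del A X = \<langle>\<sigma> X\<rangle> \<odot> (\<langle>kk A\<rangle> \<oslash> \<langle>one X\<rangle>)"

lemma sw_typing [simp]:
  assumes "has_c \<C>"
  shows "ar (sw A B X)" "dm (sw A B X) = A \<otimes> (B \<otimes> X)" "cd (sw A B X) = B \<otimes> (A \<otimes> X)"
  using assms by (simp_all add: sw_def)

lemma dup_typing [simp]:
  assumes "has_w \<C>"
  shows "ar (dup A X)" "dm (dup A X) = A \<otimes> X" "cd (dup A X) = A \<otimes> (A \<otimes> X)"
  using assms by (simp_all add: dup_def)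

lemma del_typing [simp]:
  assumes "has_k \<C>"
  shows "ar (del A X)" "dm (del A X) = A \<otimes> X" "cd (del A X) = X"
  using assms by (simp_all add: del_def)

lemma w_has_c [simp]: "has_w \<C> \<Longrightarrow> has_c \<C>" and k_has_c [simp]: "has_k \<C> \<Longrightarrow> has_c \<C>"
  by (auto simp: has_w_def has_c_def has_k_def)

section \<open>Naturality and relations of the head moves\<close>

lemma nat_sw:
  assumes "has_c \<C>" "ar f" "ar g" "ar h" "dm f = A" "dm g = B" "dm h = X" "cd f = A'" "cd g = B'" "cd h = X'"
  shows "sw A' B' X' \<odot> (f \<oslash> (g \<oslash> h)) = (g \<oslash> (f \<oslash> h)) \<odot> sw A B X"
proof -
  have "sw A' B' X' \<odot> (f \<oslash> (g \<oslash> h)) = \<langle>bl B' A' X'\<rangle> \<odot> ((\<langle>cc A' B'\<rangle> \<oslash> \<langle>one X'\<rangle>) \<odot> (((f \<oslash> g) \<oslash> h) \<odot> \<langle>br A B X\<rangle>))"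
    unfolding sw_def using nat_br[OF assms(2-4)] assms by simp
  also have "\<dots> = \<langle>bl B' A' X'\<rangle> \<odot> (((g \<oslash> f) \<oslash> h) \<odot> ((\<langle>cc A B\<rangle> \<oslash> \<langle>one X\<rangle>) \<odot> \<langle>br A B X\<rangle>))"
    using nat_c[OF assms(1-3)] assms by (simp add: interchange')
  also have "\<dots> = (g \<oslash> (f \<oslash> h)) \<odot> sw A B X"
    unfolding sw_def using nat_bl[OF assms(3,2,4), THEN comp_rest] assms by simp
  finally show ?thesis .
qed

lemma sw_sw: assumes "has_c \<C>" shows "sw B A X \<odot> sw A B X = \<langle>one (A \<otimes> (B \<otimes> X))\<rangle>"
  using assms by (simp add: sw_def interchange')

lemma nat_dup:
  assumes "has_w \<C>" "ar h" "dm h = X" "cd h = X'"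
  shows "dup A X' \<odot> (\<langle>one A\<rangle> \<oslash> h) = (\<langle>one A\<rangle> \<oslash> (\<langle>one A\<rangle> \<oslash> h)) \<odot> dup A X"
  using assms nat_bl[of "\<langle>one A\<rangle>" "\<langle>one A\<rangle>" h, symmetric, THEN comp_rest]
  by (simp add: dup_def interchange)

lemma nat_del:
  assumes "has_k \<C>" "ar h" "dm h = X" "cd h = X'"
  shows "del A X' \<odot> (\<langle>one A\<rangle> \<oslash> h) = h \<odot> del A X"
  using assms nat_\<sigma>[of h, THEN comp_rest]
  by (simp add: del_def interchange)

text \<open>The hexagon solved for the symmetry of a product; it later reduces symmetries to those
  of letters.\<close>

lemma c_prod:
  assumes c [simp]: "has_c \<C>"
  shows "\<langle>cc (A \<otimes> B) C\<rangle> = \<langle>bl C A B\<rangle> \<odot> ((\<langle>cc A C\<rangle> \<oslash> \<langle>one B\<rangle>) \<odot> (\<langle>br A C B\<rangle> \<odot>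
    ((\<langle>one A\<rangle> \<oslash> \<langle>cc B C\<rangle>) \<odot> \<langle>bl A B C\<rangle>)))"
proof -
  have "\<langle>cc (A \<otimes> B) C\<rangle> = \<langle>bl C A B\<rangle> \<odot> ((\<langle>br C A B\<rangle> \<odot> (\<langle>cc (A \<otimes> B) C\<rangle> \<odot> \<langle>br A B C\<rangle>)) \<odot> \<langle>bl A B C\<rangle>)"
    by simp
  then show ?thesis unfolding hexagon[OF c] by simp
qed

text \<open>The hexagon in the presence of a tail: a product passes \<open>C\<close> by letting
  first \<open>B\<close>, then \<open>A\<close> pass it. Beyond \<open>c_prod\<close> everything is
  rebracketing.\<close>

lemma sw_prod:
  assumes c [simp]: "has_c \<C>"
  shows "(\<langle>one C\<rangle> \<oslash> \<langle>bl A B X\<rangle>) \<odot> sw (A \<otimes> B) C X =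
    sw A C (B \<otimes> X) \<odot> ((\<langle>one A\<rangle> \<oslash> sw B C X) \<odot> \<langle>bl A B (C \<otimes> X)\<rangle>)"
proof -
  let ?x = "\<langle>one X\<rangle>"
  have split: "\<langle>cc (A \<otimes> B) C\<rangle> \<oslash> ?x = (\<langle>bl C A B\<rangle> \<oslash> ?x) \<odot> (((\<langle>cc A C\<rangle> \<oslash> \<langle>one B\<rangle>) \<oslash> ?x) \<odot>
      ((\<langle>br A C B\<rangle> \<oslash> ?x) \<odot> (((\<langle>one A\<rangle> \<oslash> \<langle>cc B C\<rangle>) \<oslash> ?x) \<odot> (\<langle>bl A B C\<rangle> \<oslash> ?x))))"
    by (subst c_prod[OF c]) (simp add: interchange)
  \<comment> \<open>Here and in \<open>mid\<close> the pentagon is used with some arrows inverted.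
    Together with \<open>pentagon_bl\<close> this turns the bracketings around each
    \<open>cc\<close> into a conjugation, which \<open>bl_br_conj\<close> removes.\<close>
  have right: "(\<langle>bl A B C\<rangle> \<oslash> ?x) \<odot> \<langle>br (A \<otimes> B) C X\<rangle> =
      \<langle>br A (B \<otimes> C) X\<rangle> \<odot> ((\<langle>one A\<rangle> \<oslash> \<langle>br B C X\<rangle>) \<odot> \<langle>bl A B (C \<otimes> X)\<rangle>)"
  proof -
    have "\<langle>br (A \<otimes> B) C X\<rangle> = (\<langle>br (A \<otimes> B) C X\<rangle> \<odot> \<langle>br A B (C \<otimes> X)\<rangle>) \<odot> \<langle>bl A B (C \<otimes> X)\<rangle>"
      by simp
    then show ?thesis unfolding pentagon by (simp add: interchange')
  qed
  have mid: "\<langle>br A C B\<rangle> \<oslash> ?x =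
      \<langle>br (A \<otimes> C) B X\<rangle> \<odot> (\<langle>br A C (B \<otimes> X)\<rangle> \<odot> ((\<langle>one A\<rangle> \<oslash> \<langle>bl C B X\<rangle>) \<odot> \<langle>bl A (C \<otimes> B) X\<rangle>))"
  proof -
    have "\<langle>br A C B\<rangle> \<oslash> ?x = ((\<langle>br A C B\<rangle> \<oslash> \<langle>one X\<rangle>) \<odot> (\<langle>br A (C \<otimes> B) X\<rangle> \<odot> (\<langle>one A\<rangle> \<oslash> \<langle>br C B X\<rangle>))) \<odot>
      ((\<langle>one A\<rangle> \<oslash> \<langle>bl C B X\<rangle>) \<odot> \<langle>bl A (C \<otimes> B) X\<rangle>)"
      by (simp add: interchange')
    then show ?thesis unfolding pentagon[symmetric] by simp
  qed
  have "(\<langle>one C\<rangle> \<oslash> \<langle>bl A B X\<rangle>) \<odot> sw (A \<otimes> B) C X =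
      ((\<langle>one C\<rangle> \<oslash> \<langle>bl A B X\<rangle>) \<odot> (\<langle>bl C (A \<otimes> B) X\<rangle> \<odot> (\<langle>bl C A B\<rangle> \<oslash> ?x))) \<odot>
      (((\<langle>cc A C\<rangle> \<oslash> \<langle>one B\<rangle>) \<oslash> ?x) \<odot> ((\<langle>br A C B\<rangle> \<oslash> ?x) \<odot> (((\<langle>one A\<rangle> \<oslash> \<langle>cc B C\<rangle>) \<oslash> ?x) \<odot>
      ((\<langle>bl A B C\<rangle> \<oslash> ?x) \<odot> \<langle>br (A \<otimes> B) C X\<rangle>))))"
    unfolding sw_def split by (simp only: comp_assoc)
  also have "\<dots> = \<langle>bl C A (B \<otimes> X)\<rangle> \<odot> ((\<langle>bl (C \<otimes> A) B X\<rangle> \<odot> (((\<langle>cc A C\<rangle> \<oslash> \<langle>one B\<rangle>) \<oslash> ?x) \<odot>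
      \<langle>br (A \<otimes> C) B X\<rangle>)) \<odot> (\<langle>br A C (B \<otimes> X)\<rangle> \<odot> ((\<langle>one A\<rangle> \<oslash> \<langle>bl C B X\<rangle>) \<odot>
      ((\<langle>bl A (C \<otimes> B) X\<rangle> \<odot> (((\<langle>one A\<rangle> \<oslash> \<langle>cc B C\<rangle>) \<oslash> ?x) \<odot>
      \<langle>br A (B \<otimes> C) X\<rangle>)) \<odot> ((\<langle>one A\<rangle> \<oslash> \<langle>br B C X\<rangle>) \<odot> \<langle>bl A B (C \<otimes> X)\<rangle>)))))"
    unfolding pentagon_bl[symmetric] right mid by (simp only: comp_assoc)
  also have "\<dots> = sw A C (B \<otimes> X) \<odot> ((\<langle>one A\<rangle> \<oslash> sw B C X) \<odot> \<langle>bl A B (C \<otimes> X)\<rangle>)"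
    by (simp add: bl_br_conj sw_def interchange')
  finally show ?thesis .
qed

lemma sw_I: assumes c [simp]: "has_c \<C>"
  shows "(\<langle>one C\<rangle> \<oslash> \<langle>\<sigma> X\<rangle>) \<odot> sw I C X = \<langle>\<sigma> (C \<otimes> X)\<rangle>"
proof -
  have "\<langle>\<delta> C\<rangle> \<odot> \<langle>cc I C\<rangle> = \<langle>\<sigma> C\<rangle>"
    by (simp flip: \<sigma>_c)
  then show ?thesis
    unfolding sw_def by (simp add: \<delta>_bl[THEN comp_rest] interchange' \<sigma>_br)
qed

text \<open>The Yang-Baxter equation for adjacent exchanges: \<open>cc A B\<close> slides by
  naturality through the exchange of a product with \<open>C\<close>, and \<open>sw_prod\<close>
  expands that exchange on either side.\<close>

lemma sw_braid:
  assumes c [simp]: "has_c \<C>"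
  shows "sw B C (A \<otimes> X) \<odot> ((\<langle>one B\<rangle> \<oslash> sw A C X) \<odot> sw A B (C \<otimes> X)) =
    (\<langle>one C\<rangle> \<oslash> sw A B X) \<odot> (sw A C (B \<otimes> X) \<odot> (\<langle>one A\<rangle> \<oslash> sw B C X))"
proof -
  let ?c = "\<langle>one C\<rangle>"
  have "(?c \<oslash> sw A B X) \<odot> (sw A C (B \<otimes> X) \<odot> (\<langle>one A\<rangle> \<oslash> sw B C X)) =
      (?c \<oslash> sw A B X) \<odot> ((sw A C (B \<otimes> X) \<odot> ((\<langle>one A\<rangle> \<oslash> sw B C X) \<odot> \<langle>bl A B (C \<otimes> X)\<rangle>)) \<odot> \<langle>br A B (C \<otimes> X)\<rangle>)"
    by simp
  also have "\<dots> = (?c \<oslash> \<langle>bl B A X\<rangle>) \<odot> (((?c \<oslash> (\<langle>cc A B\<rangle> \<oslash> \<langle>one X\<rangle>)) \<odot> sw (A \<otimes> B) C X) \<odot> \<langle>br A B (C \<otimes> X)\<rangle>)"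
    unfolding sw_prod[OF c, symmetric] by (simp add: sw_def[of A B] interchange interchange')
  also have "\<dots> = ((?c \<oslash> \<langle>bl B A X\<rangle>) \<odot> sw (B \<otimes> A) C X) \<odot> ((\<langle>cc A B\<rangle> \<oslash> \<langle>one (C \<otimes> X)\<rangle>) \<odot> \<langle>br A B (C \<otimes> X)\<rangle>)"
    using nat_sw[of "\<langle>cc A B\<rangle>" ?c "\<langle>one X\<rangle>", symmetric] by simp
  also have "\<dots> = sw B C (A \<otimes> X) \<odot> ((\<langle>one B\<rangle> \<oslash> sw A C X) \<odot> sw A B (C \<otimes> X))"
    unfolding sw_prod[OF c] by (simp add: sw_def[of A B])
  finally show ?thesis by simp
qed

lemma sw_dup:
  assumes w [simp]: "has_w \<C>"
  shows "sw A A X \<odot> dup A X = dup A X"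
  by (simp add: sw_def dup_def interchange interchange' c_w)

text \<open>Naturality of the exchange along \<open>ww A\<close>, with the exchange of
  \<open>A \<otimes> A\<close> expanded by \<open>sw_prod\<close>.\<close>

lemma dup_right_sw:
  assumes w [simp]: "has_w \<C>"
  shows "sw A C (A \<otimes> X) \<odot> ((\<langle>one A\<rangle> \<oslash> sw A C X) \<odot> dup A (C \<otimes> X)) = (\<langle>one C\<rangle> \<oslash> dup A X) \<odot> sw A C X"
proof -
  let ?c = "\<langle>one C\<rangle>"
  have "(?c \<oslash> dup A X) \<odot> sw A C X = (?c \<oslash> \<langle>bl A A X\<rangle>) \<odot> ((?c \<oslash> (\<langle>ww A\<rangle> \<oslash> \<langle>one X\<rangle>)) \<odot> sw A C X)"
    by (simp add: dup_def interchange')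
  also have "\<dots> = ((?c \<oslash> \<langle>bl A A X\<rangle>) \<odot> sw (A \<otimes> A) C X) \<odot> (\<langle>ww A\<rangle> \<oslash> \<langle>one (C \<otimes> X)\<rangle>)"
    using nat_sw[of "\<langle>ww A\<rangle>" ?c "\<langle>one X\<rangle>", symmetric] by simp
  also have "\<dots> = sw A C (A \<otimes> X) \<odot> ((\<langle>one A\<rangle> \<oslash> sw A C X) \<odot> dup A (C \<otimes> X))"
    unfolding sw_prod[OF w_has_c[OF w]] by (simp add: dup_def)
  finally show ?thesis by simp
qed

text \<open>The mirror image of \<open>dup_right_sw\<close>, obtained by cancelling exchanges
  against their inverses.\<close>

lemma dup_left_sw:
  assumes w [simp]: "has_w \<C>"
  shows "dup C (A \<otimes> X) \<odot> sw A C X = (\<langle>one C\<rangle> \<oslash> sw A C X) \<odot> (sw A C (C \<otimes> X) \<odot> (\<langle>one A\<rangle> \<oslash> dup C X))"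
proof -
  have "(\<langle>one C\<rangle> \<oslash> sw A C X) \<odot> (sw A C (C \<otimes> X) \<odot> (\<langle>one A\<rangle> \<oslash> dup C X)) =
    (\<langle>one C\<rangle> \<oslash> sw A C X) \<odot> (sw A C (C \<otimes> X) \<odot> (((\<langle>one A\<rangle> \<oslash> dup C X) \<odot> sw C A X) \<odot> sw A C X))"
    by (simp add: sw_sw)
  also have "\<dots> = (\<langle>one C\<rangle> \<oslash> sw A C X) \<odot> (sw A C (C \<otimes> X) \<odot> (sw C A (C \<otimes> X) \<odot> ((\<langle>one C\<rangle> \<oslash> sw C A X) \<odot> (dup C (A \<otimes> X) \<odot> sw A C X))))"
    unfolding dup_right_sw[OF w, symmetric] by simp
  also have "\<dots> = dup C (A \<otimes> X) \<odot> sw A C X"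
    by (simp add: sw_sw[THEN comp_rest] sw_sw interchange')
  finally show ?thesis by simp
qed

text \<open>Coassociativity of \<open>w\<close> in the presence of a tail.\<close>

lemma dup_dup:
  assumes w [simp]: "has_w \<C>"
  shows "(\<langle>one A\<rangle> \<oslash> dup A X) \<odot> dup A X = dup A (A \<otimes> X) \<odot> dup A X"
proof -
  let ?x = "\<langle>one X\<rangle>"
  have "dup A (A \<otimes> X) \<odot> dup A X = \<langle>bl A A (A \<otimes> X)\<rangle> \<odot> (\<langle>bl (A \<otimes> A) A X\<rangle> \<odot> ((((\<langle>ww A\<rangle> \<oslash> \<langle>one A\<rangle>) \<odot> \<langle>ww A\<rangle>) \<oslash> ?x)))"
    using nat_bl[of "\<langle>ww A\<rangle>" "\<langle>one A\<rangle>" ?x, symmetric, THEN comp_rest]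
    by (simp add: dup_def interchange)
  also have "\<dots> = (\<langle>bl A A (A \<otimes> X)\<rangle> \<odot> \<langle>bl (A \<otimes> A) A X\<rangle>) \<odot> ((\<langle>br A A A\<rangle> \<oslash> ?x) \<odot> (((\<langle>one A\<rangle> \<oslash> \<langle>ww A\<rangle>) \<oslash> ?x) \<odot> (\<langle>ww A\<rangle> \<oslash> ?x)))"
    unfolding w_assoc[OF w, symmetric] by (simp add: interchange)
  also have "\<dots> = (\<langle>one A\<rangle> \<oslash> \<langle>bl A A X\<rangle>) \<odot> (\<langle>bl A (A \<otimes> A) X\<rangle> \<odot> (((\<langle>one A\<rangle> \<oslash> \<langle>ww A\<rangle>) \<oslash> ?x) \<odot> (\<langle>ww A\<rangle> \<oslash> ?x)))"
    unfolding pentagon_bl by (simp add: interchange')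
  also have "\<dots> = (\<langle>one A\<rangle> \<oslash> dup A X) \<odot> dup A X"
    using nat_bl[of "\<langle>one A\<rangle>" "\<langle>ww A\<rangle>" ?x, THEN comp_rest]
    by (simp add: dup_def interchange')
  finally show ?thesis by simp
qed

text \<open>Exchange is natural along \<open>kk B\<close>, and exchange with \<open>I\<close> is
  structural by \<open>sw_I\<close>.\<close>

lemma del_sw:
  assumes k [simp]: "has_k \<C>"
  shows "del B (A \<otimes> X) \<odot> sw A B X = \<langle>one A\<rangle> \<oslash> del B X"
proof -
  have "(\<langle>one A\<rangle> \<oslash> del B X) \<odot> sw B A X = (\<langle>one A\<rangle> \<oslash> \<langle>\<sigma> X\<rangle>) \<odot> ((\<langle>one A\<rangle> \<oslash> (\<langle>kk B\<rangle> \<oslash> \<langle>one X\<rangle>)) \<odot> sw B A X)"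
    by (simp add: del_def interchange')
  also have "\<dots> = ((\<langle>one A\<rangle> \<oslash> \<langle>\<sigma> X\<rangle>) \<odot> sw I A X) \<odot> (\<langle>kk B\<rangle> \<oslash> \<langle>one (A \<otimes> X)\<rangle>)"
    using nat_sw[of "\<langle>kk B\<rangle>" "\<langle>one A\<rangle>" "\<langle>one X\<rangle>", symmetric] by simp
  also have "\<dots> = del B (A \<otimes> X)"
    unfolding sw_I[OF k_has_c[OF k]] by (simp add: del_def)
  finally show ?thesis
    using comp_rest[of "\<langle>one A\<rangle> \<oslash> del B X" "sw B A X" "del B (A \<otimes> X)" "sw A B X"] by (simp add: sw_sw)
qed

end

section \<open>Canonical morphisms between chains\<close>

text \<open>Ending in \<open>I\<close> gives even the last letter a tail, so the head moves apply to
  it without a special case.\<close>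

fun chain :: "'p list \<Rightarrow> 'p obj" where
  "chain [] = I"
| "chain (p # ps) = Letter p \<otimes> chain ps"

definition remains :: "bool \<Rightarrow> 'a \<Rightarrow> 'a list \<Rightarrow> 'a list" where
  "remains b x xs = (if b then xs else remove1 x xs)"

lemma remains_simps [simp]:
  "remains True x xs = xs"
  "remains b x [] = []"
  "remains False x (x # xs) = xs"
  "x \<noteq> y \<Longrightarrow> remains b x (y # xs) = y # remains b x xs"
  by (simp_all add: remains_def)

lemma remains_commute: "remains b x (remains b' y xs) = remains b' y (remains b x xs)"
  by (simp add: remains_def remove1_commute)

lemma in_remains [simp]: "x \<noteq> y \<Longrightarrow> y \<in> set (remains b x xs) \<longleftrightarrow> y \<in> set xs"
  by (simp add: remains_def)

locale labelled = free_kind \<C> for \<C> +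
  fixes lab :: "'a \<Rightarrow> 'p"
begin

abbreviation L :: "'a list \<Rightarrow> 'p obj" where "L xs \<equiv> chain (map lab xs)"
abbreviation lt :: "'a \<Rightarrow> 'p obj" where "lt x \<equiv> Letter (lab x)"
abbreviation e :: "'a \<Rightarrow> 'p mterm set" where "e x \<equiv> \<langle>one (lt x)\<rangle>"

text \<open>\<open>ex b x xs : L xs \<rightarrow> lt x \<otimes> L (remains b x xs)\<close> brings a copy of \<open>x\<close> (if \<open>b\<close>)
  or \<open>x\<close> itself to the front; the value \<open>{}\<close> is junk.\<close>

fun ex :: "bool \<Rightarrow> 'a \<Rightarrow> 'a list \<Rightarrow> 'p mterm set" where
  "ex b x [] = {}"
| "ex b x (i # is) =
    (if x = i then (if b then dup (lt x) (L is) else \<langle>one (L (i # is))\<rangle>)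
     else sw (lt i) (lt x) (L (remains b x is)) \<odot> (e i \<oslash> ex b x is))"

text \<open>Labels never requested stay in \<open>src\<close> and are discarded together at the end.
  For empty \<open>src\<close> the identity stands in for \<open>kk I\<close>: it is the same
  morphism if \<open>k\<close> is present, and is typed also if \<open>k\<close> is absent.\<close>

fun N :: "'a list \<Rightarrow> 'a list \<Rightarrow> 'p mterm set" where
  "N src [] = (if src = [] then \<langle>one I\<rangle> else \<langle>kk (L src)\<rangle>)"
| "N src (x # ks) =
    (e x \<oslash> N (remains (x \<in> set ks) x src) ks) \<odot> ex (x \<in> set ks) x src"

text \<open>Label lists that a morphism from \<open>src\<close> can produce.\<close>

definition adm :: "'a list \<Rightarrow> 'a list \<Rightarrow> bool" where
  "adm src ks \<longleftrightarrow> distinct src \<and> set ks \<subseteq> set src \<and> (\<not> has_w \<C> \<longrightarrow> distinct ks) \<and>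
     (\<not> has_k \<C> \<longrightarrow> set ks = set src) \<and> (\<not> has_c \<C> \<longrightarrow> ks = src)"

section \<open>Relations between extractions of labels\<close>

lemma ex_typing:
  assumes "x \<in> set xs" "b \<Longrightarrow> has_w \<C>" "has_c \<C> \<or> hd xs = x"
  shows "ar (ex b x xs) \<and> dm (ex b x xs) = L xs \<and> cd (ex b x xs) = lt x \<otimes> L (remains b x xs)"
  using assms by (induction xs) auto

lemma ex_typing_c [simp]:
  assumes "x \<in> set xs" "b \<Longrightarrow> has_w \<C>" "has_c \<C>"
  shows "ar (ex b x xs)" "dm (ex b x xs) = L xs" "cd (ex b x xs) = lt x \<otimes> L (remains b x xs)"
  using assms ex_typing[of x xs b] by auto

text \<open>The base of \<open>ex_commute\<close>. If \<open>x\<close> at the head is copied, the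
  extracted \<open>y\<close> has to pass both copies, which is \<open>dup_right_sw\<close>.\<close>

lemma ex_commute_head:
  assumes c [simp]: "has_c \<C>" and b [simp]: "b \<Longrightarrow> has_w \<C>" "b' \<Longrightarrow> has_w \<C>"
    and [simp]: "x \<noteq> y" "y \<noteq> x" "y \<in> set xs"
  shows "sw (lt x) (lt y) (L (remains b' y (remains b x (x # xs)))) \<odot>
      ((e x \<oslash> ex b' y (remains b x (x # xs))) \<odot> ex b x (x # xs)) =
    (e y \<oslash> ex b x (remains b' y (x # xs))) \<odot> ex b' y (x # xs)"
proof (cases b)
  case False
  then show ?thesis by simp
next
  case True
  then have w: "has_w \<C>" by simp
  let ?X = "lt x" and ?Y = "lt y" and ?R = "L (remains b' y xs)" and ?ey = "ex b' y xs"
  have "sw ?X ?Y (?X \<otimes> ?R) \<odot> ((e x \<oslash> (sw ?X ?Y ?R \<odot> (e x \<oslash> ?ey))) \<odot> dup ?X (L xs))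
    = sw ?X ?Y (?X \<otimes> ?R) \<odot> ((e x \<oslash> sw ?X ?Y ?R) \<odot> ((e x \<oslash> (e x \<oslash> ?ey)) \<odot> dup ?X (L xs)))"
    by (simp add: interchange')
  also have "\<dots> = (sw ?X ?Y (?X \<otimes> ?R) \<odot> ((e x \<oslash> sw ?X ?Y ?R) \<odot> dup ?X (?Y \<otimes> ?R))) \<odot> (e x \<oslash> ?ey)"
    by (subst nat_dup[symmetric, of ?ey]) (simp_all add: w)
  also have "\<dots> = (e y \<oslash> dup ?X ?R) \<odot> (sw ?X ?Y ?R \<odot> (e x \<oslash> ?ey))"
    unfolding dup_right_sw[OF w] by simp
  finally show ?thesis using True by simp
qed

text \<open>If the head \<open>i\<close> is neither \<open>x\<close> nor \<open>y\<close>, both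
  labels pass it, and the Yang-Baxter equation moves the exchange of \<open>x\<close> and
  \<open>y\<close> into the tail, where the induction hypothesis applies.\<close>

lemma ex_commute:
  assumes c [simp]: "has_c \<C>" and b [simp]: "b \<Longrightarrow> has_w \<C>" "b' \<Longrightarrow> has_w \<C>"
    and "x \<noteq> y" "x \<in> set xs" "y \<in> set xs"
  shows "sw (lt x) (lt y) (L (remains b' y (remains b x xs))) \<odot>
      ((e x \<oslash> ex b' y (remains b x xs)) \<odot> ex b x xs) =
    (e y \<oslash> ex b x (remains b' y xs)) \<odot> ex b' y xs"
  using assms(4-6)
proof (induction xs)
  case (Cons i xs)
  let ?R = "remains b' y (remains b x xs)"
  let ?X = "lt x" and ?Y = "lt y" and ?I = "lt i"
  consider "i = x" | "i = y" | "i \<noteq> x" "i \<noteq> y" by blast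
  then show ?case
  proof cases
    case 1
    then show ?thesis using Cons.prems ex_commute_head[of b b' x y xs] by simp
  next
    case 2
    then have "sw (lt y) (lt x) (L (remains b x (remains b' y (i # xs)))) \<odot>
        ((e y \<oslash> ex b x (remains b' y (i # xs))) \<odot> ex b' y (i # xs)) =
      (e x \<oslash> ex b' y (remains b x (i # xs))) \<odot> ex b x (i # xs)"
      using Cons.prems ex_commute_head[of b' b y x xs] by auto
    \<comment> \<open>The head lemma was applied with \<open>x\<close> and \<open>y\<close>
      interchanged; composing with an exchange and cancelling by \<open>sw_sw\<close> turns it into
      the desired orientation.\<close>
    from arg_cong[OF this, of "\<lambda>f. sw (lt x) (lt y) (L (remains b x (remains b' y (i # xs)))) \<odot> f"]
    have "(e y \<oslash> ex b x (remains b' y (i # xs))) \<odot> ex b' y (i # xs) =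
      sw (lt x) (lt y) (L (remains b x (remains b' y (i # xs)))) \<odot>
        ((e x \<oslash> ex b' y (remains b x (i # xs))) \<odot> ex b x (i # xs))"
      using Cons.prems 2 by (simp add: sw_sw[THEN comp_rest] del: ex.simps remains_simps)
    then show ?thesis by (simp only: remains_commute)
  next
    case 3
    then have [simp]: "x \<in> set xs" "y \<in> set xs" "x \<noteq> y" "y \<noteq> x" "x \<noteq> i" "y \<noteq> i" using Cons.prems by auto
    let ?ex = "ex b x xs" and ?ey = "ex b' y xs"
    let ?ex' = "ex b x (remains b' y xs)" and ?ey' = "ex b' y (remains b x xs)"
    have R: "remains b x (remains b' y xs) = ?R" by (rule remains_commute)
    have "sw ?X ?Y (?I \<otimes> L ?R) \<odot> ((e x \<oslash> (sw ?I ?Y (L ?R) \<odot> (e i \<oslash> ?ey'))) \<odot>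
        (sw ?I ?X (L (remains b x xs)) \<odot> (e i \<oslash> ?ex)))
      = sw ?X ?Y (?I \<otimes> L ?R) \<odot> ((e x \<oslash> sw ?I ?Y (L ?R)) \<odot> (((e x \<oslash> (e i \<oslash> ?ey')) \<odot>
        sw ?I ?X (L (remains b x xs))) \<odot> (e i \<oslash> ?ex)))"
      by (simp add: interchange')
    also have "\<dots> = (sw ?X ?Y (?I \<otimes> L ?R) \<odot> ((e x \<oslash> sw ?I ?Y (L ?R)) \<odot> sw ?I ?X (?Y \<otimes> L ?R))) \<odot>
        (e i \<oslash> ((e x \<oslash> ?ey') \<odot> ?ex))"
      by (subst nat_sw[symmetric, of _ _ ?ey']) (simp_all add: interchange)
    also have "\<dots> = (e y \<oslash> sw ?I ?X (L ?R)) \<odot> (sw ?I ?Y (?X \<otimes> L ?R) \<odot> (e i \<oslash> (sw ?X ?Y (L ?R) \<odot> ((e x \<oslash> ?ey') \<odot> ?ex))))"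
      unfolding sw_braid[OF c] by (simp add: interchange)
    also have "\<dots> = (e y \<oslash> sw ?I ?X (L ?R)) \<odot> (sw ?I ?Y (?X \<otimes> L ?R) \<odot> (e i \<oslash> ((e y \<oslash> ?ex') \<odot> ?ey)))"
      by (subst Cons.IH) simp_all
    also have "\<dots> = (e y \<oslash> sw ?I ?X (L ?R)) \<odot> ((sw ?I ?Y (?X \<otimes> L ?R) \<odot> (e i \<oslash> (e y \<oslash> ?ex'))) \<odot> (e i \<oslash> ?ey))"
      by (simp add: interchange)
    also have "\<dots> = (e y \<oslash> (sw ?I ?X (L ?R) \<odot> (e i \<oslash> ?ex'))) \<odot> (sw ?I ?Y (L (remains b' y xs)) \<odot> (e i \<oslash> ?ey))"
      by (subst nat_sw[of "e i" "e y" ?ex']) (simp_all add: interchange' R)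
    finally show ?thesis using R by simp
  qed
qed simp

text \<open>Two copies of one label are interchangeable: this is cocommutativity of \<open>w\<close>
  at the place of \<open>x\<close>, carried past the labels before it by the Yang-Baxter equation
  with two equal factors.\<close>

lemma ex_twice:
  assumes w [simp]: "has_w \<C>" and "x \<in> set xs"
  shows "sw (lt x) (lt x) (L (remains b x xs)) \<odot> ((e x \<oslash> ex b x xs) \<odot> ex True x xs) =
    (e x \<oslash> ex b x xs) \<odot> ex True x xs"
  using assms(2)
proof (induction xs)
  case (Cons i xs)
  let ?X = "lt x" and ?I = "lt i" and ?R = "L (remains b x xs)"
  show ?case
  proof (cases "i = x")
    case True
    then show ?thesis
      using sw_dup[OF w, THEN comp_rest] by (cases b) (auto simp: sw_dup dup_dup)
  next
    case False
    then have [simp]: "x \<in> set xs" "x \<noteq> i" using Cons.prems by auto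
    let ?ex = "ex b x xs" and ?et = "ex True x xs"
    have split: "(e x \<oslash> (sw ?I ?X ?R \<odot> (e i \<oslash> ?ex))) \<odot> (sw ?I ?X (L xs) \<odot> (e i \<oslash> ?et))
      = (e x \<oslash> sw ?I ?X ?R) \<odot> (sw ?I ?X (?X \<otimes> ?R) \<odot> (e i \<oslash> ((e x \<oslash> ?ex) \<odot> ?et)))"
    proof -
      have "(e x \<oslash> (sw ?I ?X ?R \<odot> (e i \<oslash> ?ex))) \<odot> (sw ?I ?X (L xs) \<odot> (e i \<oslash> ?et)) =
        (e x \<oslash> sw ?I ?X ?R) \<odot> (((e x \<oslash> (e i \<oslash> ?ex)) \<odot> sw ?I ?X (L xs)) \<odot> (e i \<oslash> ?et))"
        by (simp add: interchange')
      also have "\<dots> = (e x \<oslash> sw ?I ?X ?R) \<odot> (sw ?I ?X (?X \<otimes> ?R) \<odot> (e i \<oslash> ((e x \<oslash> ?ex) \<odot> ?et)))"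
        by (subst nat_sw[symmetric, of "e i" "e x" ?ex]) (simp_all add: interchange)
      finally show ?thesis .
    qed
    have "sw ?X ?X (?I \<otimes> ?R) \<odot> ((e x \<oslash> sw ?I ?X ?R) \<odot> (sw ?I ?X (?X \<otimes> ?R) \<odot> (e i \<oslash> ((e x \<oslash> ?ex) \<odot> ?et))))
      = (e x \<oslash> sw ?I ?X ?R) \<odot> (sw ?I ?X (?X \<otimes> ?R) \<odot> (e i \<oslash> (sw ?X ?X ?R \<odot> ((e x \<oslash> ?ex) \<odot> ?et))))"
      using sw_braid[OF w_has_c[OF w], THEN comp_rest3, of ?X ?X ?I ?R] by (simp add: interchange)
    then show ?thesis
      unfolding Cons.IH[OF \<open>x \<in> set xs\<close>] using False by (simp add: split[simplified])
  qed
qed simp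

text \<open>At the place of \<open>x\<close> this is trivial or coassociativity, according to
  \<open>b\<close>; \<open>dup_left_sw\<close> carries it past the labels before
  \<open>x\<close>.\<close>

lemma ex_dup:
  assumes w [simp]: "has_w \<C>" and "x \<in> set xs"
  shows "dup (lt x) (L (remains b x xs)) \<odot> ex b x xs = (e x \<oslash> ex b x xs) \<odot> ex True x xs"
  using assms(2)
proof (induction xs)
  case (Cons i xs)
  let ?X = "lt x" and ?I = "lt i" and ?R = "L (remains b x xs)"
  show ?case
  proof (cases "i = x")
    case True
    then show ?thesis by (cases b) (auto simp: dup_dup)
  next
    case False
    then have [simp]: "x \<in> set xs" "x \<noteq> i" using Cons.prems by auto
    let ?ex = "ex b x xs" and ?et = "ex True x xs"
    have "dup ?X (?I \<otimes> ?R) \<odot> (sw ?I ?X ?R \<odot> (e i \<oslash> ?ex)) =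
      (e x \<oslash> sw ?I ?X ?R) \<odot> (sw ?I ?X (?X \<otimes> ?R) \<odot> (e i \<oslash> (dup ?X ?R \<odot> ?ex)))"
      by (simp add: dup_left_sw[OF w, THEN comp_rest] interchange)
    also have "\<dots> = (e x \<oslash> sw ?I ?X ?R) \<odot> ((sw ?I ?X (?X \<otimes> ?R) \<odot> (e i \<oslash> (e x \<oslash> ?ex))) \<odot> (e i \<oslash> ?et))"
      unfolding Cons.IH[OF \<open>x \<in> set xs\<close>] by (simp add: interchange)
    also have "\<dots> = (e x \<oslash> (sw ?I ?X ?R \<odot> (e i \<oslash> ?ex))) \<odot> (sw ?I ?X (L xs) \<odot> (e i \<oslash> ?et))"
      by (subst nat_sw[of "e i" "e x" ?ex]) (simp_all add: interchange')
    finally show ?thesis using False by simp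
  qed
qed simp

text \<open>An instance of \<open>ex_commute\<close> in which \<open>x\<close> is moved; by
  \<open>del_sw\<close> the deletion of \<open>x\<close> absorbs the exchange.\<close>

lemma ex_del:
  assumes k [simp]: "has_k \<C>" and b [simp]: "b \<Longrightarrow> has_w \<C>" and x [simp]: "x \<noteq> y" "x \<in> set xs" "y \<in> set xs"
  shows "(e y \<oslash> (del (lt x) (L (remains b y (remove1 x xs))) \<odot> ex False x (remains b y xs))) \<odot> ex b y xs =
    ex b y (remove1 x xs) \<odot> (del (lt x) (L (remove1 x xs)) \<odot> ex False x xs)"
proof -
  have [simp]: "y \<noteq> x" by (rule not_sym[OF x(1)])
  have [simp]: "remains False x = remove1 x" by (rule ext) (simp add: remains_def)
  let ?R = "L (remains b y (remove1 x xs))"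
  have R: "remove1 x (remains b y xs) = remains b y (remove1 x xs)"
    by (simp add: remains_def remove1_commute)
  have y [simp]: "y \<in> set (remove1 x xs)" by simp
  have "(e y \<oslash> (del (lt x) ?R \<odot> ex False x (remains b y xs))) \<odot> ex b y xs =
    (e y \<oslash> del (lt x) ?R) \<odot> ((e y \<oslash> ex False x (remains b y xs)) \<odot> ex b y xs)"
    by (simp add: interchange' R)
  also have "\<dots> = del (lt x) (lt y \<otimes> ?R) \<odot> (sw (lt y) (lt x) ?R \<odot> ((e y \<oslash> ex False x (remains b y xs)) \<odot> ex b y xs))"
    by (simp flip: del_sw[OF k])
  also have "\<dots> = del (lt x) (lt y \<otimes> ?R) \<odot> ((e x \<oslash> ex b y (remove1 x xs)) \<odot> ex False x xs)"
    using ex_commute[of b False y x xs] by (simp add: R)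
  also have "\<dots> = ex b y (remove1 x xs) \<odot> (del (lt x) (L (remove1 x xs)) \<odot> ex False x xs)"
    using nat_del[OF k, of "ex b y (remove1 x xs)", THEN comp_rest] by simp
  finally show ?thesis .
qed

section \<open>Canonical morphisms under exchange, duplication and deletion\<close>

lemma adm_Cons:
  assumes "adm src (x # ks)"
  shows "adm (remains (x \<in> set ks) x src) ks" "x \<in> set src" "x \<in> set ks \<Longrightarrow> has_w \<C>"
    "has_c \<C> \<or> hd src = x"
proof -
  show "x \<in> set src" "x \<in> set ks \<Longrightarrow> has_w \<C>" "has_c \<C> \<or> hd src = x"
    using assms unfolding adm_def by (simp, metis distinct.simps(2), metis list.sel(1))
  have d: "distinct src" "set (x # ks) \<subseteq> set src" "\<not> has_w \<C> \<Longrightarrow> distinct (x # ks)"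
    "\<not> has_k \<C> \<Longrightarrow> set (x # ks) = set src" "\<not> has_c \<C> \<Longrightarrow> src = x # ks"
    using assms unfolding adm_def by simp_all
  have r: "set (remains (x \<in> set ks) x src) = (if x \<in> set ks then set src else set src - {x})"
    using d(1) by (simp add: remains_def)
  show "adm (remains (x \<in> set ks) x src) ks"
    unfolding adm_def r
  proof (intro conjI impI)
    show "distinct (remains (x \<in> set ks) x src)" using d(1) by (simp add: remains_def)
    show "set ks \<subseteq> (if x \<in> set ks then set src else set src - {x})" using d(2) by (simp; blast)
    show "distinct ks" if "\<not> has_w \<C>" using d(3)[OF that] by simp
    show "set ks = (if x \<in> set ks then set src else set src - {x})" if "\<not> has_k \<C>"
      unfolding d(4)[OF that, symmetric] by (simp add: insert_absorb)
    show "ks = remains (x \<in> set ks) x src" if "\<not> has_c \<C>"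
      using d(1) unfolding d(5)[OF that] by (simp add: remains_def)
  qed
qed

lemma N_typing [simp]:
  assumes "adm src ks"
  shows "ar (N src ks)" "dm (N src ks) = L src" "cd (N src ks) = L ks"
proof -
  have "ar (N src ks) \<and> dm (N src ks) = L src \<and> cd (N src ks) = L ks"
    using assms
  proof (induction ks arbitrary: src)
    case Nil
    then show ?case by (cases "has_k \<C>") (auto simp: adm_def)
  next
    case (Cons x ks)
    note a = adm_Cons[OF Cons.prems]
    show ?case using Cons.IH[OF a(1)] ex_typing[OF a(2-4)] by simp
  qed
  then show "ar (N src ks)" "dm (N src ks) = L src" "cd (N src ks) = L ks" by simp_all
qed

text \<open>Each requested label is already in front and not requested again, so every extraction is
  an identity.\<close>

lemma N_self: "distinct xs \<Longrightarrow> N xs xs = \<langle>one (L xs)\<rangle>"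
  by (induction xs) auto

text \<open>Distinct labels are handled by \<open>ex_commute\<close>. If the labels are equal, the
  first extraction copies, and \<open>ex_twice\<close> absorbs the exchange of the copies.\<close>

lemma N_sw:
  assumes c [simp]: "has_c \<C>" and "adm src (x # y # ks)"
  shows "sw (lt x) (lt y) (L ks) \<odot> N src (x # y # ks) = N src (y # x # ks)"
proof -
  note a = adm_Cons[OF assms(2)] and a' = adm_Cons[OF adm_Cons(1)[OF assms(2)]]
  show ?thesis
  proof (cases "x = y")
    case True
    then have w [simp]: "has_w \<C>" using a(3) by simp
    have [simp]: "y \<in> set src" "adm (remains (y \<in> set ks) y src) ks" using a a' True by auto
    let ?n = "N (remains (y \<in> set ks) y src) ks" and ?ex = "ex (y \<in> set ks) y src" and ?et = "ex True y src"
    have "sw (lt y) (lt y) (L ks) \<odot> ((e y \<oslash> (e y \<oslash> ?n)) \<odot> ((e y \<oslash> ?ex) \<odot> ?et)) =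
      (e y \<oslash> (e y \<oslash> ?n)) \<odot> (sw (lt y) (lt y) (L (remains (y \<in> set ks) y src)) \<odot> ((e y \<oslash> ?ex) \<odot> ?et))"
      using nat_sw[OF c, of "e y" "e y" ?n, THEN comp_rest] by simp
    also have "\<dots> = (e y \<oslash> (e y \<oslash> ?n)) \<odot> ((e y \<oslash> ?ex) \<odot> ?et)"
      by (subst ex_twice) simp_all
    finally show ?thesis using True by (simp add: interchange')
  next
    case False
    let ?b = "x \<in> set ks" and ?b' = "y \<in> set ks"
    have [simp]: "x \<noteq> y" "y \<noteq> x" "?b \<Longrightarrow> has_w \<C>" "?b' \<Longrightarrow> has_w \<C>" "x \<in> set src" "y \<in> set src"
      "adm (remains ?b' y (remains ?b x src)) ks"
      using False a a' by auto
    have R: "remains ?b x (remains ?b' y src) = remains ?b' y (remains ?b x src)"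
      by (rule remains_commute)
    let ?n = "N (remains ?b' y (remains ?b x src)) ks"
    have "sw (lt x) (lt y) (L ks) \<odot> ((e x \<oslash> (e y \<oslash> ?n)) \<odot> ((e x \<oslash> ex ?b' y (remains ?b x src)) \<odot> ex ?b x src)) =
      (e y \<oslash> (e x \<oslash> ?n)) \<odot> (sw (lt x) (lt y) (L (remains ?b' y (remains ?b x src))) \<odot>
        ((e x \<oslash> ex ?b' y (remains ?b x src)) \<odot> ex ?b x src))"
      using nat_sw[OF c, of "e x" "e y" ?n, THEN comp_rest] by simp
    also have "\<dots> = (e y \<oslash> (e x \<oslash> ?n)) \<odot> ((e y \<oslash> ex ?b x (remains ?b' y src)) \<odot> ex ?b' y src)"
      by (subst ex_commute) simp_all
    finally show ?thesis by (simp add: interchange' R)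
  qed
qed

lemma N_dup:
  assumes w [simp]: "has_w \<C>" and "adm src (x # ks)"
  shows "dup (lt x) (L ks) \<odot> N src (x # ks) = N src (x # x # ks)"
proof -
  note a [simp] = adm_Cons(1,2)[OF assms(2)]
  let ?n = "N (remains (x \<in> set ks) x src) ks" and ?ex = "ex (x \<in> set ks) x src"
  have "dup (lt x) (L ks) \<odot> ((e x \<oslash> ?n) \<odot> ?ex) =
    (e x \<oslash> (e x \<oslash> ?n)) \<odot> (dup (lt x) (L (remains (x \<in> set ks) x src)) \<odot> ?ex)"
    using nat_dup[OF w, of ?n, THEN comp_rest] by simp
  also have "\<dots> = (e x \<oslash> (e x \<oslash> ?n)) \<odot> ((e x \<oslash> ?ex) \<odot> ex True x src)"
    by (subst ex_dup) simp_all
  finally show ?thesis by (simp add: interchange')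
qed

lemma terminal:
  assumes "has_k \<C>" "ar f" "ar g" "dm f = dm g" "cd f = I" "cd g = I"
  shows "f = g"
  using nat_k[of f] nat_k[of g] assms by (simp add: k_I)

text \<open>\<open>N\<close> discards leftovers at the end; \<open>ex_del\<close> carries the
  deletion of one leftover back to the beginning, past each extraction. Once nothing is left to
  extract, terminality of \<open>I\<close> settles the claim.\<close>

lemma N_remove:
  assumes k [simp]: "has_k \<C>" and "x \<in> set src" "x \<notin> set ks" "adm src ks"
  shows "N src ks = N (remove1 x src) ks \<odot> (del (lt x) (L (remove1 x src)) \<odot> ex False x src)"
  using assms(2-4)
proof (induction ks arbitrary: src)
  case Nil
  have [simp]: "adm (remove1 x src) []" "adm src []" "remains False x src = remove1 x src"
    using Nil by (auto simp: adm_def remains_def)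
  show ?case using Nil
    by (intro terminal) (simp_all del: N.simps)
next
  case (Cons y ks)
  note a = adm_Cons[OF Cons.prems(3)]
  let ?b = "y \<in> set ks"
  have [simp]: "x \<noteq> y" "y \<noteq> x" "?b \<Longrightarrow> has_w \<C>" "y \<in> set src" "x \<notin> set ks" "x \<in> set src"
    using Cons.prems a by auto
  have [simp]: "remains False x xs = remove1 x xs" for xs by (simp add: remains_def)
  have R: "remove1 x (remains ?b y src) = remains ?b y (remove1 x src)"
    by (simp add: remains_def remove1_commute)
  have "adm (remove1 x src) (y # ks)"
    using Cons.prems by (auto simp: adm_def)
  from adm_Cons(1)[OF this] have [simp]: "adm (remains ?b y (remove1 x src)) ks" .
  let ?n = "N (remains ?b y (remove1 x src)) ks"
  have "N src (y # ks) = (e y \<oslash> (?n \<odot> (del (lt x) (L (remains ?b y (remove1 x src))) \<odot> ex False x (remains ?b y src)))) \<odot> ex ?b y src"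
    using Cons.IH[OF _ _ a(1)] by (simp add: R)
  also have "\<dots> = (e y \<oslash> ?n) \<odot> ((e y \<oslash> (del (lt x) (L (remains ?b y (remove1 x src))) \<odot> ex False x (remains ?b y src))) \<odot> ex ?b y src)"
    by (simp add: interchange' R)
  also have "\<dots> = N (remove1 x src) (y # ks) \<odot> (del (lt x) (L (remove1 x src)) \<odot> ex False x src)"
    by (subst ex_del) simp_all
  finally show ?case .
qed

text \<open>Without \<open>w\<close> the label \<open>x\<close> is not requested again, so it was
  moved to the front, not copied. Deleting it there is then the early deletion of a leftover
  described by \<open>N_remove\<close>.\<close>

lemma N_del:
  assumes k [simp]: "has_k \<C>" and "\<not> has_w \<C>" and "adm src (x # ks)"
  shows "del (lt x) (L ks) \<odot> N src (x # ks) = N src ks"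
proof -
  note a = adm_Cons[OF assms(3)]
  have [simp]: "x \<notin> set ks" "x \<in> set src" using a assms by auto
  have "adm src ks" using assms(3) by (auto simp: adm_def)
  have r: "remains False x src = remove1 x src" by (simp add: remains_def)
  then have [simp]: "adm (remove1 x src) ks" using a(1) by simp
  have "del (lt x) (L ks) \<odot> ((e x \<oslash> N (remove1 x src) ks) \<odot> ex False x src) =
    N (remove1 x src) ks \<odot> (del (lt x) (L (remove1 x src)) \<odot> ex False x src)"
    using nat_del[OF k, of "N (remove1 x src) ks", THEN comp_rest] by simp
  then show ?thesis
    using N_remove[OF k _ _ \<open>adm src ks\<close>, of x] by (simp add: r)
qed

end

section \<open>Transport of morphisms to chains\<close>

context free_kind
begin

text \<open>Flattening of \<open>A\<close> onto the tail \<open>chain xs\<close>, which serves as an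
  accumulator: of a product, the right factor is absorbed into the tail before the left one. The
  inverse is \<open>nui\<close>.\<close>

fun nu :: "'p obj \<Rightarrow> 'p list \<Rightarrow> 'p mterm set" where
  "nu (Letter p) xs = \<langle>one (Letter p \<otimes> chain xs)\<rangle>"
| "nu I xs = \<langle>\<sigma> (chain xs)\<rangle>"
| "nu (A \<otimes> B) xs = nu A (flat B @ xs) \<odot> ((\<langle>one A\<rangle> \<oslash> nu B xs) \<odot> \<langle>bl A B (chain xs)\<rangle>)"

fun nui :: "'p obj \<Rightarrow> 'p list \<Rightarrow> 'p mterm set" where
  "nui (Letter p) xs = \<langle>one (Letter p \<otimes> chain xs)\<rangle>"
| "nui I xs = \<langle>\<sigma>i (chain xs)\<rangle>"
| "nui (A \<otimes> B) xs = \<langle>br A B (chain xs)\<rangle> \<odot> ((\<langle>one A\<rangle> \<oslash> nui B xs) \<odot> nui A (flat B @ xs))"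

lemma nu_typing:
  "ar (nu A xs) \<and> dm (nu A xs) = A \<otimes> chain xs \<and> cd (nu A xs) = chain (flat A @ xs)"
  by (induction A arbitrary: xs) simp_all

lemma nui_typing:
  "ar (nui A xs) \<and> dm (nui A xs) = chain (flat A @ xs) \<and> cd (nui A xs) = A \<otimes> chain xs"
  by (induction A arbitrary: xs) simp_all

lemmas nu_typing' [simp] = nu_typing[THEN conjunct1] nu_typing[THEN conjunct2, THEN conjunct1]
  nu_typing[THEN conjunct2, THEN conjunct2]
lemmas nui_typing' [simp] = nui_typing[THEN conjunct1] nui_typing[THEN conjunct2, THEN conjunct1]
  nui_typing[THEN conjunct2, THEN conjunct2]

lemma nu_nui: "nu A xs \<odot> nui A xs = \<langle>one (chain (flat A @ xs))\<rangle> \<and> nui A xs \<odot> nu A xs = \<langle>one (A \<otimes> chain xs)\<rangle>"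
proof (induction A arbitrary: xs)
  case (Prod A B)
  note ih = Prod.IH(1)[THEN conjunct1, THEN comp_rest] Prod.IH(1)[THEN conjunct2, THEN comp_rest]
  show ?case
    using Prod.IH by (simp add: interchange' ih)
qed simp_all

lemmas nu_nui' [simp] = nu_nui[THEN conjunct1] nu_nui[THEN conjunct2]
  nu_nui[THEN conjunct1, THEN comp_rest] nu_nui[THEN conjunct2, THEN comp_rest]

fun pre :: "'p list \<Rightarrow> 'p mterm set \<Rightarrow> 'p mterm set" where
  "pre [] h = h"
| "pre (p # ps) h = \<langle>one (Letter p)\<rangle> \<oslash> pre ps h"

lemma pre_append: "pre (ps @ qs) h = pre ps (pre qs h)"
  by (induction ps) simp_all

lemma pre_typing [simp]:
  assumes "ar h" "dm h = chain xs" "cd h = chain ys"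
  shows "ar (pre ps h)" "dm (pre ps h) = chain (ps @ xs)" "cd (pre ps h) = chain (ps @ ys)"
proof -
  have "ar (pre ps h) \<and> dm (pre ps h) = chain (ps @ xs) \<and> cd (pre ps h) = chain (ps @ ys)"
    using assms by (induction ps) simp_all
  then show "ar (pre ps h)" "dm (pre ps h) = chain (ps @ xs)" "cd (pre ps h) = chain (ps @ ys)"
    by simp_all
qed

text \<open>Naturality of flattening in the tail; an identity on \<open>A\<close> becomes identities
  on its letters, which \<open>pre\<close> multiplies one at a time.\<close>

lemma nat_nu:
  assumes "ar h" "dm h = chain xs" "cd h = chain ys"
  shows "nu A ys \<odot> (\<langle>one A\<rangle> \<oslash> h) = pre (flat A) h \<odot> nu A xs"
  using assms
proof (induction A arbitrary: h xs ys)
  case I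
  then show ?case using nat_\<sigma>[of h] by simp
next
  case (Prod A B)
  have "nu (A \<otimes> B) ys \<odot> (\<langle>one (A \<otimes> B)\<rangle> \<oslash> h) =
      nu A (flat B @ ys) \<odot> ((\<langle>one A\<rangle> \<oslash> (nu B ys \<odot> (\<langle>one B\<rangle> \<oslash> h))) \<odot> \<langle>bl A B (chain xs)\<rangle>)"
    using nat_bl[of "\<langle>one A\<rangle>" "\<langle>one B\<rangle>" h] Prod.prems by (simp add: interchange')
  also have "\<dots> = (nu A (flat B @ ys) \<odot> (\<langle>one A\<rangle> \<oslash> pre (flat B) h)) \<odot> ((\<langle>one A\<rangle> \<oslash> nu B xs) \<odot> \<langle>bl A B (chain xs)\<rangle>)"
    unfolding Prod.IH(2)[OF Prod.prems] using Prod.prems by (simp add: interchange')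
  also have "\<dots> = pre (flat (A \<otimes> B)) h \<odot> nu (A \<otimes> B) xs"
    using Prod.prems by (simp add: Prod.IH(1)[of _ "flat B @ xs" "flat B @ ys"] pre_append)
  finally show ?case .
qed simp

text \<open>Conjugation by flattening, with a spectator tail \<open>xs\<close>. Multiplying
  \<open>f\<close> on the right by an identity then merely lengthens the tail.\<close>

definition transport :: "'p mterm set \<Rightarrow> 'p list \<Rightarrow> 'p mterm set" where
  "transport f xs = nu (cd f) xs \<odot> ((f \<oslash> \<langle>one (chain xs)\<rangle>) \<odot> nui (dm f) xs)"

section \<open>Transport under composition and multiplication\<close>

lemma transport_typing [simp]:
  assumes "ar f"
  shows "ar (transport f xs)" "dm (transport f xs) = chain (flat (dm f) @ xs)"
    "cd (transport f xs) = chain (flat (cd f) @ xs)"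
  using assms by (simp_all add: transport_def)

lemma transport_comp: "ar f \<Longrightarrow> ar g \<Longrightarrow> dm g = cd f \<Longrightarrow> transport (g \<odot> f) xs = transport g xs \<odot> transport f xs"
  by (simp add: transport_def interchange')

lemma transport_one [simp]: "transport \<langle>one A\<rangle> xs = \<langle>one (chain (flat A @ xs))\<rangle>"
  by (simp add: transport_def)

lemma transport_mult_one: "ar f \<Longrightarrow> transport (f \<oslash> \<langle>one D\<rangle>) xs = transport f (flat D @ xs)"
proof -
  assume f [simp]: "ar f"
  let ?x = "\<langle>one (chain xs)\<rangle>"
  let ?d = "\<langle>one D\<rangle>"
  have "transport (f \<oslash> ?d) xs = nu (cd f) (flat D @ xs) \<odot> ((\<langle>one (cd f)\<rangle> \<oslash> nu D xs) \<odot>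
     ((\<langle>bl (cd f) D (chain xs)\<rangle> \<odot> (((f \<oslash> ?d) \<oslash> ?x) \<odot> \<langle>br (dm f) D (chain xs)\<rangle>)) \<odot>
     ((\<langle>one (dm f)\<rangle> \<oslash> nui D xs) \<odot> nui (dm f) (flat D @ xs))))"
    by (simp add: transport_def)
  also have "\<dots> = transport f (flat D @ xs)"
    by (subst bl_br_conj) (simp_all add: transport_def interchange' interchange)
  finally show ?thesis .
qed

lemma transport_one_mult: "ar g \<Longrightarrow> transport (\<langle>one A\<rangle> \<oslash> g) xs = pre (flat A) (transport g xs)"
proof -
  assume g [simp]: "ar g"
  let ?x = "\<langle>one (chain xs)\<rangle>"
  let ?a = "\<langle>one A\<rangle>"
  have "transport (?a \<oslash> g) xs = nu A (flat (cd g) @ xs) \<odot> ((?a \<oslash> nu (cd g) xs) \<odot>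
     ((\<langle>bl A (cd g) (chain xs)\<rangle> \<odot> (((?a \<oslash> g) \<oslash> ?x) \<odot> \<langle>br A (dm g) (chain xs)\<rangle>)) \<odot>
     ((?a \<oslash> nui (dm g) xs) \<odot> nui A (flat (dm g) @ xs))))"
    by (simp add: transport_def)
  also have "\<dots> = (nu A (flat (cd g) @ xs) \<odot> (?a \<oslash> transport g xs)) \<odot> nui A (flat (dm g) @ xs)"
    by (subst bl_br_conj) (simp_all add: transport_def interchange')
  also have "\<dots> = pre (flat A) (transport g xs)"
    by (subst nat_nu[where xs = "flat (dm g) @ xs"]) simp_all
  finally show ?thesis .
qed

text \<open>Undoing the flattening with empty tail recovers the product of \<open>f\<close> with the
  identity of \<open>I\<close>, and naturality of \<delta> recovers \<open>f\<close> from that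
  product.\<close>

lemma transport_inj:
  assumes "ar f" "ar g" "dm f = dm g" "cd f = cd g" "transport f [] = transport g []"
  shows "f = g"
proof -
  have "f = \<langle>\<delta> (cd f)\<rangle> \<odot> ((f \<oslash> \<langle>one I\<rangle>) \<odot> \<langle>\<delta>i (dm f)\<rangle>)" if "ar f" for f :: "'p mterm set"
    using nat_\<delta>[OF that, symmetric, THEN comp_rest] that by simp
  moreover have "f \<oslash> \<langle>one I\<rangle> = nui (cd f) [] \<odot> (transport f [] \<odot> nu (dm f) [])" if "ar f" for f :: "'p mterm set"
    using that by (simp add: transport_def)
  ultimately show ?thesis using assms by metis
qed

text \<open>The coherence part of the argument: flattening ignores units and brackets, in that a
  structural morphism followed by the flattening of its target is the flattening of its source. For
  \<open>br\<close> this is the pentagon.\<close>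

lemma transport_structural:
  "transport \<langle>\<sigma> A\<rangle> xs = \<langle>one (chain (flat A @ xs))\<rangle>"
  "transport \<langle>\<delta> A\<rangle> xs = \<langle>one (chain (flat A @ xs))\<rangle>"
  "transport \<langle>br A B C\<rangle> xs = \<langle>one (chain (flat A @ flat B @ flat C @ xs))\<rangle>"
proof -
  let ?x = "\<langle>one (chain xs)\<rangle>"
  have "nu A xs \<odot> (\<langle>\<sigma> A\<rangle> \<oslash> ?x) = nu (I \<otimes> A) xs"
    using nat_\<sigma>[of "nu A xs", THEN comp_rest] by (simp flip: \<sigma>_bl)
  from this[THEN comp_rest] show "transport \<langle>\<sigma> A\<rangle> xs = \<langle>one (chain (flat A @ xs))\<rangle>"
    using nu_nui'(1)[of "I \<otimes> A" xs] by (simp add: transport_def del: nu.simps nui.simps)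
  have "nu A xs \<odot> (\<langle>\<delta> A\<rangle> \<oslash> ?x) = nu (A \<otimes> I) xs"
    by (simp add: \<delta>_bl)
  from this[THEN comp_rest] show "transport \<langle>\<delta> A\<rangle> xs = \<langle>one (chain (flat A @ xs))\<rangle>"
    using nu_nui'(1)[of "A \<otimes> I" xs] by (simp add: transport_def del: nu.simps nui.simps)
  have "nu ((A \<otimes> B) \<otimes> C) xs \<odot> (\<langle>br A B C\<rangle> \<oslash> ?x) = nu (A \<otimes> (B \<otimes> C)) xs"
  proof -
    have "nu ((A \<otimes> B) \<otimes> C) xs \<odot> (\<langle>br A B C\<rangle> \<oslash> ?x) =
      nu A (flat B @ flat C @ xs) \<odot> ((\<langle>one A\<rangle> \<oslash> nu B (flat C @ xs)) \<odot>
      ((\<langle>one A\<rangle> \<oslash> (\<langle>one B\<rangle> \<oslash> nu C xs)) \<odot> ((\<langle>bl A B (C \<otimes> chain xs)\<rangle> \<odot> \<langle>bl (A \<otimes> B) C (chain xs)\<rangle>) \<odot> (\<langle>br A B C\<rangle> \<oslash> ?x))))"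
      using nat_bl[of "\<langle>one A\<rangle>" "\<langle>one B\<rangle>" "nu C xs", THEN comp_rest] by simp
    also have "\<dots> = nu (A \<otimes> (B \<otimes> C)) xs"
      unfolding pentagon_bl by (simp add: interchange' interchange)
    finally show ?thesis .
  qed
  from this[THEN comp_rest] show "transport \<langle>br A B C\<rangle> xs = \<langle>one (chain (flat A @ flat B @ flat C @ xs))\<rangle>"
    using nu_nui'(1)[of "A \<otimes> (B \<otimes> C)" xs] by (simp add: transport_def del: nu.simps nui.simps)
qed

text \<open>Transport respects composition, so the inverse of a morphism transported to an identity
  is itself transported to an identity.\<close>

lemma transport_structural_inverse:
  "transport \<langle>\<sigma>i A\<rangle> xs = \<langle>one (chain (flat A @ xs))\<rangle>"
  "transport \<langle>\<delta>i A\<rangle> xs = \<langle>one (chain (flat A @ xs))\<rangle>"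
  "transport \<langle>bl A B C\<rangle> xs = \<langle>one (chain (flat A @ flat B @ flat C @ xs))\<rangle>"
  subgoal using transport_comp[of "\<langle>\<sigma>i A\<rangle>" "\<langle>\<sigma> A\<rangle>" xs] by (simp add: transport_structural)
  subgoal using transport_comp[of "\<langle>\<delta>i A\<rangle>" "\<langle>\<delta> A\<rangle>" xs] by (simp add: transport_structural)
  subgoal using transport_comp[of "\<langle>bl A B C\<rangle>" "\<langle>br A B C\<rangle>" xs] by (simp add: transport_structural)
  done

end

section \<open>Which labels an action may drop, repeat or permute\<close>

lemma set_act_subset: "length l = width (tdom f) \<Longrightarrow> typed \<C> f \<Longrightarrow> set (act f l) \<subseteq> set l"
proof (induction f arbitrary: l)
  case (cc A B)
  then show ?case using set_drop_subset set_take_subset by fastforce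
next
  case (Compose g f)
  then show ?case using length_act[of \<C> f l] by (simp; blast)
next
  case (Multiply f g)
  then have "set (act f (take (width (tdom f)) l)) \<subseteq> set (take (width (tdom f)) l)"
    "set (act g (drop (width (tdom f)) l)) \<subseteq> set (drop (width (tdom f)) l)"
    by simp_all
  then show ?case using set_drop_subset set_take_subset by fastforce
qed simp_all

lemma set_take_Un_drop: "set (take n l) \<union> set (drop n l) = set l" "set (drop n l) \<union> set (take n l) = set l"
  by (metis append_take_drop_id set_append, metis Un_commute append_take_drop_id set_append)

lemma set_act:
  "length l = width (tdom f) \<Longrightarrow> typed \<C> f \<Longrightarrow> \<not> has_k \<C> \<Longrightarrow> set (act f l) = set l"
proof (induction f arbitrary: l)
  case (Compose g f)
  then show ?case using length_act[of \<C> f l] by simp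
qed (simp_all add: set_take_Un_drop)

text \<open>In a product each factor draws only on its own block of labels, and the two blocks are
  disjoint.\<close>

lemma distinct_act:
  "length l = width (tdom f) \<Longrightarrow> typed \<C> f \<Longrightarrow> \<not> has_w \<C> \<Longrightarrow> distinct l \<Longrightarrow> distinct (act f l)"
proof (induction f arbitrary: l)
  case (cc A B)
  then show ?case using append_take_drop_id[of "width A" l]
    by (metis Int_commute act.simps(1) distinct_append)
next
  case (Compose g f)
  then show ?case using length_act[of \<C> f l] by simp
next
  case (Multiply f g)
  let ?l = "take (width (tdom f)) l" and ?r = "drop (width (tdom f)) l"
  have "distinct (?l @ ?r)" using Multiply.prems by simp
  then have "set ?l \<inter> set ?r = {}" by (simp only: distinct_append)
  moreover have "set (act f ?l) \<subseteq> set ?l" "set (act g ?r) \<subseteq> set ?r"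
    using Multiply.prems set_act_subset[of ?l f \<C>] set_act_subset[of ?r g \<C>] by simp_all
  ultimately show ?case using Multiply by (simp; blast)
qed simp_all

lemma act_no_c:
  "length l = width (tdom f) \<Longrightarrow> typed \<C> f \<Longrightarrow> \<not> has_c \<C> \<Longrightarrow> act f l = l"
proof (induction f arbitrary: l)
  case (Compose g f)
  then show ?case using length_act[of \<C> f l] by simp
qed (auto simp: has_c_def has_w_def has_k_def)

lemma map_act:
  "map h l = flat (tdom f) \<Longrightarrow> typed \<C> f \<Longrightarrow> map h (act f l) = flat (tcod f)"
  by (induction f arbitrary: l) (simp_all add: take_map[symmetric] drop_map[symmetric])

context labelled
begin

lemma adm_act:
  assumes "adm src (lu @ la @ lx)" "typed \<C> f" "length la = width (tdom f)"
  shows "adm src (lu @ act f la @ lx)"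
proof -
  note s = set_act_subset[OF assms(3,2)]
  note d = assms(1)[unfolded adm_def]
  show ?thesis
    unfolding adm_def
  proof (intro conjI impI)
    show "distinct src" using d by blast
    show "set (lu @ act f la @ lx) \<subseteq> set src" using d s by auto
    show "distinct (lu @ act f la @ lx)" if "\<not> has_w \<C>"
    proof -
      have "distinct (lu @ la @ lx)" using d that by blast
      then show ?thesis using s distinct_act[OF assms(3,2) that] by auto
    qed
    show "set (lu @ act f la @ lx) = set src" if "\<not> has_k \<C>"
      using d set_act[OF assms(3,2) that] that by (metis set_append)
    show "lu @ act f la @ lx = src" if "\<not> has_c \<C>"
      using d act_no_c[OF assms(3,2) that] that by metis
  qed
qed

text \<open>The last premise makes \<open>N\<close> take the same decision between copying and
  moving on both sides for each prefix label. The extractions then coincide, and \<open>h\<close>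
  only meets the recursive remainder of \<open>N\<close>, whose source has changed; hence the
  premise on \<open>h\<close> for all \<open>src'\<close>.\<close>

lemma N_prefix:
  assumes "adm src (lu @ ks)" "adm src (lu @ ks')" "ar h" "dm h = L ks" "cd h = L ks'"
    and "\<And>src'. adm src' ks \<Longrightarrow> adm src' ks' \<Longrightarrow> h \<odot> N src' ks = N src' ks'"
    and "\<And>u. u \<in> set lu \<Longrightarrow> u \<in> set ks \<longleftrightarrow> u \<in> set ks'"
  shows "pre (map lab lu) h \<odot> N src (lu @ ks) = N src (lu @ ks')"
  using assms(1,2,7)
proof (induction lu arbitrary: src)
  case Nil
  then show ?case using assms(6) by simp
next
  case (Cons u lu)
  have b: "u \<in> set (lu @ ks) \<longleftrightarrow> u \<in> set (lu @ ks')" using Cons.prems by simp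
  let ?src = "remains (u \<in> set (lu @ ks)) u src"
  have a1: "adm ?src (lu @ ks)"
    using adm_Cons(1)[of src u "lu @ ks"] Cons.prems(1) by simp
  have a2: "adm ?src (lu @ ks')"
    unfolding b using adm_Cons(1)[of src u "lu @ ks'"] Cons.prems(2) by simp
  have "pre (map lab lu) h \<odot> N ?src (lu @ ks) = N ?src (lu @ ks')"
    using Cons.prems(3) by (intro Cons.IH a1 a2) simp
  then have "(e u \<oslash> pre (map lab lu) h) \<odot> ((e u \<oslash> N ?src (lu @ ks)) \<odot> ex (u \<in> set (lu @ ks)) u src) =
      (e u \<oslash> N ?src (lu @ ks')) \<odot> ex (u \<in> set (lu @ ks)) u src"
    by (simp only: interchange') simp
  then show ?case using b by simp
qed

text \<open>Source and tail are arbitrary so that the property survives induction on terms: a right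
  factor enlarges the tail, and a prefix changes the source.\<close>

definition tracks :: "'p mterm \<Rightarrow> bool" where
  "tracks f \<longleftrightarrow> typed \<C> f \<and> (\<forall>src la lx. map lab la = flat (tdom f) \<longrightarrow> adm src (la @ lx) \<longrightarrow>
     transport \<langle>f\<rangle> (map lab lx) \<odot> N src (la @ lx) = N src (act f la @ lx))"

lemma tracksD:
  "tracks f \<Longrightarrow> map lab la = flat (tdom f) \<Longrightarrow> adm src (la @ lx) \<Longrightarrow>
    transport \<langle>f\<rangle> (map lab lx) \<odot> N src (la @ lx) = N src (act f la @ lx)"
  by (simp add: tracks_def)

lemma tracks_typed: "tracks f \<Longrightarrow> typed \<C> f"
  by (simp add: tracks_def)

section \<open>Closure of tracking under the operations on terms\<close>

lemma tracks_compose: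
  assumes f: "tracks f" and g: "tracks g" and fg: "tdom g = tcod f"
  shows "tracks (g \<bullet> f)"
  unfolding tracks_def
proof (intro conjI allI impI)
  note t [simp] = tracks_typed[OF f] tracks_typed[OF g]
  show "typed \<C> (g \<bullet> f)" using fg by simp
  fix src la lx
  assume la: "map lab la = flat (tdom (g \<bullet> f))" and a: "adm src (la @ lx)"
  have "adm src (act f la @ lx)"
    using adm_act[of src "[]" la lx f] a arg_cong[OF la, of length] by simp
  then show "transport \<langle>g \<bullet> f\<rangle> (map lab lx) \<odot> N src (la @ lx) = N src (act (g \<bullet> f) la @ lx)"
    using tracksD[OF f _ a] tracksD[OF g, of "act f la" src lx] la fg map_act[of lab la f \<C>]
    by (simp add: transport_comp ar_cls dm_cls cd_cls)
qed

lemma tracks_structural: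
  assumes "typed \<C> f" "\<And>l. act f l = (l :: 'a list)"
    and "\<And>xs. transport \<langle>f\<rangle> xs = \<langle>one (chain (flat (tdom f) @ xs))\<rangle>"
  shows "tracks f"
  using assms by (simp add: tracks_def)

lemma map_eq_append_split:
  assumes "map h l = xs @ ys"
  shows "map h (take (length xs) l) = xs" "map h (drop (length xs) l) = ys"
  by (simp_all add: assms flip: take_map drop_map)

lemma tracks_mult_one:
  assumes f: "tracks f" shows "tracks (f \<star> one D)"
  unfolding tracks_def
proof (intro conjI allI impI)
  note t [simp] = tracks_typed[OF f]
  show "typed \<C> (f \<star> one D)" by simp
  fix src la lx
  assume la: "map lab la = flat (tdom (f \<star> one D))" and a: "adm src (la @ lx)"
  define l r where "l = take (width (tdom f)) la" and "r = drop (width (tdom f)) la"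
  have lr: "la = l @ r" "map lab l = flat (tdom f)" "map lab r = flat D"
    using la map_eq_append_split[of lab la] by (auto simp: l_def r_def)
  have "length l = width (tdom f)" using arg_cong[OF lr(2), of length] by simp
  then show "transport \<langle>f \<star> one D\<rangle> (map lab lx) \<odot> N src (la @ lx) = N src (act (f \<star> one D) la @ lx)"
    using tracksD[OF f, of l src "r @ lx"] a lr by (simp add: transport_mult_one ar_cls)
qed

lemma tracks_one_mult:
  assumes g: "tracks g" and kw: "\<not> (has_w \<C> \<and> has_k \<C>)" shows "tracks (one A \<star> g)"
  unfolding tracks_def
proof (intro conjI allI impI)
  note t [simp] = tracks_typed[OF g]
  show "typed \<C> (one A \<star> g)" by simp
  fix src la lx
  assume la: "map lab la = flat (tdom (one A \<star> g))" and a: "adm src (la @ lx)"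
  define l r where "l = take (width A) la" and "r = drop (width A) la"
  have lr: "la = l @ r" "map lab l = flat A" "map lab r = flat (tdom g)"
    using la map_eq_append_split[of lab la] by (auto simp: l_def r_def)
  have len: "length l = width A" "length r = width (tdom g)"
    using arg_cong[OF lr(2), of length] arg_cong[OF lr(3), of length] by simp_all
  have a1: "adm src (l @ (r @ lx))" using a lr by simp
  have a2: "adm src (l @ (act g r @ lx))"
    using adm_act[OF a1 _ len(2)] by simp
  \<comment> \<open>This is where the restriction on \<open>w\<close> and \<open>k\<close> is used.
    With \<open>k\<close> there is no \<open>w\<close>, so both label lists are distinct and
    \<open>u\<close> occurs after the prefix in neither; without \<open>k\<close> the action
    preserves the set of labels.\<close>
  have "u \<in> set (r @ lx) \<longleftrightarrow> u \<in> set (act g r @ lx)" if "u \<in> set l" for u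
  proof (cases "has_k \<C>")
    case True
    then have "distinct (l @ r @ lx)" "distinct (l @ act g r @ lx)"
      using kw a1 a2 unfolding adm_def by blast+
    then show ?thesis using that by auto
  next
    case False
    then show ?thesis using set_act[OF len(2) t] by simp
  qed
  then have "pre (map lab l) (transport \<langle>g\<rangle> (map lab lx)) \<odot> N src (l @ (r @ lx)) = N src (l @ (act g r @ lx))"
    using lr map_act[OF lr(3) t] by (intro N_prefix a1 a2 tracksD[OF g]) (simp_all add: ar_cls dm_cls cd_cls)
  then show "transport \<langle>one A \<star> g\<rangle> (map lab lx) \<odot> N src (la @ lx) = N src (act (one A \<star> g) la @ lx)"
    using lr len by (simp add: transport_one_mult ar_cls)
qed

lemma tracks_cong:
  assumes f: "tracks f" and fg: "(f, g) \<in> term_equiv \<C>"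
  shows "tracks g"
proof -
  have "same_act \<C> TYPE('a) f g" by (rule term_equiv_same_act[OF fg])
  moreover have "length la = width (tdom f)" if "map lab la = flat (tdom f)" for la
    using arg_cong[OF that, of length] by simp
  ultimately show ?thesis
    using f cls_eqI[OF fg] unfolding tracks_def same_act_def by metis
qed

text \<open>Tracking of \<open>f\<close> on the labels \<open>act g la\<close> leads back to
  \<open>la\<close>; the transport of \<open>g\<close> then cancels that of
  \<open>f\<close>.\<close>

lemma tracks_inverse:
  assumes f: "tracks f" and g: "typed \<C> g" "(f \<bullet> g, one B) \<in> term_equiv \<C>" "(g \<bullet> f, one A) \<in> term_equiv \<C>"
  shows "tracks g"
  unfolding tracks_def
proof (intro conjI allI impI)
  note t = term_equiv_typed[OF g(2)] term_equiv_typed[OF g(3)]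
  show "typed \<C> g" by fact
  fix src la lx
  assume la: "map lab la = flat (tdom g)" and a: "adm src (la @ lx)"
  have len: "length la = width (tdom g)" using arg_cong[OF la, of length] by simp
  have inv: "act f (act g la) = la"
    using term_equiv_same_act[OF g(2), of "TYPE('a)"] len by (simp add: same_act_def)
  have a': "adm src (act g la @ lx)" using adm_act[of src "[]" la lx g] a g len by simp
  have "transport \<langle>f\<rangle> (map lab lx) \<odot> N src (act g la @ lx) = N src (la @ lx)"
    using tracksD[OF f _ a'] map_act[OF la g(1)] t inv by simp
  then have "transport \<langle>g\<rangle> (map lab lx) \<odot> N src (la @ lx) =
      transport (\<langle>g\<rangle> \<odot> \<langle>f\<rangle>) (map lab lx) \<odot> N src (act g la @ lx)"
    using t by (simp add: transport_comp ar_cls dm_cls cd_cls)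
  also have "\<langle>g\<rangle> \<odot> \<langle>f\<rangle> = \<langle>one A\<rangle>" using cls_eqI[OF g(3)] by simp
  finally show "transport \<langle>g\<rangle> (map lab lx) \<odot> N src (la @ lx) = N src (act g la @ lx)"
    using a' map_act[OF la g(1)] t by simp
qed

lemma tracks_monoidal:
  "tracks (one A)" "tracks (\<sigma> A)" "tracks (\<sigma>i A)" "tracks (\<delta> A)" "tracks (\<delta>i A)"
  "tracks (br A B C)" "tracks (bl A B C)"
  by (rule tracks_structural; simp add: transport_structural transport_structural_inverse)+

text \<open>The product is split by interchange into a left and a right multiplication by an
  identity.\<close>

lemma tracks_multiply:
  assumes f: "tracks f" and g: "tracks g" and kw: "\<not> (has_w \<C> \<and> has_k \<C>)"
  shows "tracks (f \<star> g)"
proof -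
  note t [simp] = tracks_typed[OF f] tracks_typed[OF g]
  have "tracks ((f \<star> one (tcod g)) \<bullet> (one (tdom f) \<star> g))"
    by (intro tracks_compose tracks_one_mult[OF g kw] tracks_mult_one[OF f]) simp
  moreover have "\<langle>(f \<star> one (tcod g)) \<bullet> (one (tdom f) \<star> g)\<rangle> = \<langle>f \<star> g\<rangle>"
    by (simp add: interchange ar_cls dm_cls cd_cls)
  ultimately show ?thesis
    using tracks_cong cls_eq_iff tracks_typed by metis
qed

lemma tracks_eqI: "tracks f \<Longrightarrow> \<langle>f\<rangle> = \<langle>g\<rangle> \<Longrightarrow> tracks g"
  using tracks_cong cls_eq_iff tracks_typed by metis

lemma tracks_invI:
  assumes "tracks f" "typed \<C> g" "\<langle>f\<rangle> \<odot> \<langle>g\<rangle> = \<langle>one B\<rangle>" "\<langle>g\<rangle> \<odot> \<langle>f\<rangle> = \<langle>one A\<rangle>"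
  shows "tracks g"
  using assms tracks_inverse[of f g B A] cls_eq_iff[of "one B" "f \<bullet> g"] cls_eq_iff[of "one A" "g \<bullet> f"]
    term_equiv.intros(3) by (metis cls_compose typed_simps(1))

section \<open>Tracking for \<open>c\<close>, \<open>w\<close> and \<open>k\<close>\<close>

lemma tracks_c_letter:
  assumes c [simp]: "has_c \<C>" shows "tracks (cc (Letter p) (Letter q))"
  unfolding tracks_def
proof (intro conjI allI impI)
  show "typed \<C> (cc (Letter p) (Letter q))" by simp
  fix src la lx
  assume la: "map lab la = flat (tdom (cc (Letter p) (Letter q)))" and a: "adm src (la @ lx)"
  from la obtain x y where xy: "la = [x, y]" "p = lab x" "q = lab y" by auto
  have "transport \<langle>cc (Letter p) (Letter q)\<rangle> (map lab lx) = sw (lt x) (lt y) (L lx)"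
    by (simp add: transport_def sw_def xy)
  then show "transport \<langle>cc (Letter p) (Letter q)\<rangle> (map lab lx) \<odot> N src (la @ lx) =
      N src (act (cc (Letter p) (Letter q)) la @ lx)"
    using N_sw[OF c, of src x y lx] a xy by (simp del: N.simps)
qed

text \<open>Induction on the left argument: exchange with \<open>I\<close> is structural by
  \<open>\<sigma>_c\<close>, and exchange with a product is expanded by the hexagon.\<close>

lemma tracks_c_step:
  assumes kw: "\<not> (has_w \<C> \<and> has_k \<C>)" and c [simp]: "has_c \<C>"
    and letter: "\<And>p. tracks (cc (Letter p) B)"
  shows "tracks (cc A B)"
proof (induction A)
  case (Letter p)
  then show ?case by (rule letter)
next
  case I
  have "\<langle>\<delta>i B \<bullet> \<sigma> B\<rangle> = \<langle>\<delta>i B\<rangle> \<odot> ((\<langle>\<sigma> B\<rangle> \<odot> \<langle>cc B I\<rangle>) \<odot> \<langle>cc I B\<rangle>)"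
    by simp
  also have "\<dots> = \<langle>cc I B\<rangle>"
    unfolding \<sigma>_c[OF c] by simp
  finally show ?case
    using tracks_eqI[of "\<delta>i B \<bullet> \<sigma> B"] tracks_compose tracks_monoidal by (metis tdom.simps(5) tcod.simps(2))
next
  case (Prod A1 A2)
  let ?t = "bl B A1 A2 \<bullet> ((cc A1 B \<star> one A2) \<bullet> (br A1 B A2 \<bullet> ((one A1 \<star> cc A2 B) \<bullet> bl A1 A2 B)))"
  have "tracks ?t"
    by (intro tracks_compose tracks_multiply tracks_monoidal Prod kw) simp_all
  then show ?case
    by (rule tracks_eqI) (simp add: c_prod)
qed

text \<open>The step is applied twice. Starting from two letters it frees the left argument;
  inversion puts the remaining letter on the left, where the step frees it too.\<close>

lemma tracks_c:
  assumes kw: "\<not> (has_w \<C> \<and> has_k \<C>)" and c [simp]: "has_c \<C>"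
  shows "tracks (cc A B)"
proof (rule tracks_c_step[OF kw c])
  fix p
  have "tracks (cc B (Letter p))"
    by (rule tracks_c_step[OF kw c tracks_c_letter[OF c]])
  then show "tracks (cc (Letter p) B)"
    by (rule tracks_invI) simp_all
qed

lemma tracks_w:
  assumes kw: "\<not> (has_w \<C> \<and> has_k \<C>)" and w [simp]: "has_w \<C>"
  shows "tracks (ww A)"
proof (induction A)
  case (Letter p)
  show ?case
    unfolding tracks_def
  proof (intro conjI allI impI)
    show "typed \<C> (ww (Letter p))" by simp
    fix src la lx
    assume la: "map lab la = flat (tdom (ww (Letter p)))" and a: "adm src (la @ lx)"
    from la obtain x where x: "la = [x]" "p = lab x" by auto
    have "transport \<langle>ww (Letter p)\<rangle> (map lab lx) = dup (lt x) (L lx)"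
      by (simp add: transport_def dup_def x)
    then show "transport \<langle>ww (Letter p)\<rangle> (map lab lx) \<odot> N src (la @ lx) = N src (act (ww (Letter p)) la @ lx)"
      using N_dup[OF w, of src x lx] a x by (simp del: N.simps)
  qed
next
  case I
  \<comment> \<open>Since \<sigma> at \<open>I\<close> is invertible, the equation
    \<open>\<sigma>_w\<close> identifies \<open>ww I\<close> with its inverse.\<close>
  have "\<langle>\<sigma>i I\<rangle> = \<langle>\<sigma>i I\<rangle> \<odot> (\<langle>\<sigma> I\<rangle> \<odot> \<langle>ww I\<rangle>)"
    by (simp add: \<sigma>_w)
  also have "\<dots> = \<langle>ww I\<rangle>" by simp
  finally show ?case by (rule tracks_eqI[OF tracks_monoidal(3)])
next
  case (Prod A B)
  \<comment> \<open>\<open>cm A A B B\<close> undoes \<open>cm A B A B\<close>, both exchanging the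
    two middle factors; this solves the \<open>w\<close>-equation for products for
    \<open>ww (A \<otimes> B)\<close>.\<close>
  let ?t = "cm A A B B \<bullet> (ww A \<star> ww B)"
  have "tracks (cm A A B B)"
    unfolding cm_def
    by (intro tracks_compose tracks_multiply tracks_monoidal tracks_c kw) simp_all
  then have "tracks ?t"
    by (intro tracks_compose tracks_multiply Prod kw) (simp_all add: cm_def)
  moreover have "\<langle>?t\<rangle> = \<langle>ww (A \<otimes> B)\<rangle>"
  proof -
    have "\<langle>?t\<rangle> = \<langle>cm A A B B\<rangle> \<odot> (\<langle>cm A B A B\<rangle> \<odot> \<langle>ww (A \<otimes> B)\<rangle>)"
      by (simp add: cm_w)
    also have "\<langle>cm A A B B\<rangle> \<odot> (\<langle>cm A B A B\<rangle> \<odot> \<langle>ww (A \<otimes> B)\<rangle>) = \<langle>ww (A \<otimes> B)\<rangle>"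
      by (simp add: cm_def interchange')
    finally show ?thesis .
  qed
  ultimately show ?case by (rule tracks_eqI)
qed

lemma tracks_k:
  assumes kw: "\<not> (has_w \<C> \<and> has_k \<C>)" and k [simp]: "has_k \<C>"
  shows "tracks (kk A)"
proof (induction A)
  case (Letter p)
  show ?case
    unfolding tracks_def
  proof (intro conjI allI impI)
    show "typed \<C> (kk (Letter p))" by simp
    fix src la lx
    assume la: "map lab la = flat (tdom (kk (Letter p)))" and a: "adm src (la @ lx)"
    from la obtain x where x: "la = [x]" "p = lab x" by auto
    have "transport \<langle>kk (Letter p)\<rangle> (map lab lx) = del (lt x) (L lx)"
      by (simp add: transport_def del_def x)
    then show "transport \<langle>kk (Letter p)\<rangle> (map lab lx) \<odot> N src (la @ lx) = N src (act (kk (Letter p)) la @ lx)"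
      using N_del[OF k, of src x lx] a x kw by (simp del: N.simps)
  qed
next
  case I
  show ?case by (rule tracks_eqI[OF tracks_monoidal(1)]) (simp add: k_I)
next
  case (Prod A B)
  have "tracks (\<sigma> I \<bullet> (kk A \<star> kk B))"
    by (intro tracks_compose tracks_multiply tracks_monoidal Prod kw) simp
  \<comment> \<open>Both terms have target \<open>I\<close>, which is terminal.\<close>
  then show ?case
    by (rule tracks_eqI) (rule terminal, simp_all)
qed

lemma tracks_typed_term:
  assumes "\<not> (has_w \<C> \<and> has_k \<C>)"
  shows "typed \<C> f \<Longrightarrow> tracks f"
  by (induction f)
    (simp_all add: tracks_monoidal tracks_c[OF assms] tracks_w[OF assms] tracks_k[OF assms]
      tracks_compose tracks_multiply[OF _ _ assms])

text \<open>For distinct labels \<open>N la la\<close> is an identity, so tracking says that the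
  transport of \<open>f\<close> is itself the canonical morphism for
  \<open>act f la\<close>.\<close>

lemma cls_eqI_act:
  assumes "\<not> (has_w \<C> \<and> has_k \<C>)" and f: "typed \<C> f" and g: "typed \<C> g"
    and t: "tdom f = tdom g" "tcod f = tcod g"
    and la: "distinct la" "map lab la = flat (tdom f)" "act f la = act g la"
  shows "\<langle>f\<rangle> = \<langle>g\<rangle>"
proof (rule transport_inj)
  have a: "adm la (la @ [])" using la by (simp add: adm_def)
  have "transport \<langle>f\<rangle> (map lab []) \<odot> N la (la @ []) = transport \<langle>g\<rangle> (map lab []) \<odot> N la (la @ [])"
    using tracksD[OF tracks_typed_term[OF assms(1) f] _ a] tracksD[OF tracks_typed_term[OF assms(1) g] _ a] la t
    by simp
  then show "transport \<langle>f\<rangle> [] = transport \<langle>g\<rangle> []"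
    using la t f g by (simp add: N_self ar_cls dm_cls cd_cls)
qed (simp_all add: f g t ar_cls dm_cls cd_cls)

end

section \<open>The embeddings\<close>

context free_kind
begin

lemma Hom_free_iff: "X \<in> Hom (free_category \<C>) A B \<longleftrightarrow> ar X \<and> dm X = A \<and> cd X = B"
  by (auto simp: free_category_def quotient_def has_type_iff cls_def[symmetric] mclass_def[symmetric]
      ar_cls dm_cls cd_cls elim!: arE)

lemma Cmp_free: "Cmp (free_category \<C>) Y X = Y \<odot> X"
  by (simp add: free_category_def comp_def cls_def del: cls_compose)

lemma Ident_free: "Ident (free_category \<C>) A = \<langle>one A\<rangle>"
  by (simp add: free_category_def cls_def)

lemma Ob_free: "Ob (free_category \<C>) = UNIV"
  by (simp add: free_category_def)

lemma category_free: "category (free_category \<C>)"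
  by unfold_locales (auto simp: Hom_free_iff Cmp_free Ident_free Ob_free)

lemma cls_eqI_act_upt:
  fixes f g :: "'p mterm"
  assumes "\<not> (has_w \<C> \<and> has_k \<C>)" "typed \<C> f" "typed \<C> g" "tdom f = tdom g" "tcod f = tcod g"
    and "act f [0..<width (tdom f)] = act g [0..<width (tdom f)]"
  shows "\<langle>f\<rangle> = \<langle>g\<rangle>"
proof -
  \<comment> \<open>The labels are the positions in the source, distinct even where letters repeat;
    \<open>lab\<close> returns the letter at a position.\<close>
  interpret labelled \<C> "\<lambda>i::nat. flat (tdom f) ! i" .
  show ?thesis
    using assms by (intro cls_eqI_act[where la = "[0..<width (tdom f)]"]) (simp_all add: map_nth)
qed

end

section \<open>Passage to a larger category\<close>

definition kind_le :: "kind \<Rightarrow> kind \<Rightarrow> bool" where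
  "kind_le \<C> \<D> \<longleftrightarrow> (has_c \<C> \<longrightarrow> has_c \<D>) \<and> (has_w \<C> \<longrightarrow> has_w \<D>) \<and> (has_k \<C> \<longrightarrow> has_k \<D>)"

lemma has_type_mono: "\<C> \<turnstile> f : A \<rightarrow> B \<Longrightarrow> kind_le \<C> \<D> \<Longrightarrow> \<D> \<turnstile> f : A \<rightarrow> B"
  by (induction rule: has_type.induct) (auto intro: has_type.intros simp: kind_le_def)

lemma equation_mono:
  assumes le: "kind_le \<C> \<D>" and "equation \<C> s t" shows "equation \<D> s t"
proof -
  note t = has_type_mono[OF _ le]
  have "monoidal_eq \<C> s t \<Longrightarrow> monoidal_eq \<D> s t"
    by (erule monoidal_eq.cases; simp only:; intro monoidal_eq.intros t; assumption)
  moreover have "c_eq \<C> s t \<Longrightarrow> c_eq \<D> s t"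
    by (erule c_eq.cases; simp only:; intro c_eq.intros t; assumption)
  moreover have "w_eq \<C> s t \<Longrightarrow> w_eq \<D> s t"
    by (erule w_eq.cases; simp only:; intro w_eq.intros t; assumption)
  moreover have "k_eq \<C> s t \<Longrightarrow> k_eq \<D> s t"
    by (erule k_eq.cases; simp only:; intro k_eq.intros t; assumption)
  ultimately show ?thesis
    using assms unfolding equation_def kind_le_def by blast
qed

lemma term_equiv_mono: "(f, g) \<in> term_equiv \<C> \<Longrightarrow> kind_le \<C> \<D> \<Longrightarrow> (f, g) \<in> term_equiv \<D>"
proof (induction rule: term_equiv.induct)
  case (4 f g h)
  then show ?case using term_equiv.intros(4) by blast
next
  case (5 f f' g g' A B C)
  then show ?case using term_equiv.intros(5) has_type_mono by blast
qed (auto intro: term_equiv.intros equation_mono has_type_mono)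

text \<open>The two categories play different parts: from \<D> only preservation of the action is
  used, from \<C> that the action separates morphisms. Hence the condition on \<open>w\<close> and
  \<open>k\<close> concerns \<C> alone.\<close>

lemma free_subcategory_if_faithful:
  assumes le: "kind_le \<C> \<D>" and kw: "\<not> (has_w \<C> \<and> has_k \<C>)"
  shows "free_subcategory TYPE('p) \<C> \<D>"
proof -
  interpret C: free_kind \<C> .
  interpret D: free_kind \<D> .
  \<comment> \<open>A definition without choice of representatives: terms equivalent in \<C> are
    equivalent in \<D>, so on a class of \<C> the union is of equal classes.\<close>
  define Fm :: "'p mterm set \<Rightarrow> 'p mterm set" where "Fm X = (\<Union>f\<in>X. mclass \<D> f)" for X
  have typed_mono: "typed \<D> f" if "typed \<C> f" for f :: "'p mterm"
    using that has_type_mono[OF _ le] unfolding typed_def by blast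
  have Fm: "Fm (C.cls f) = D.cls f" if "typed \<C> f" for f
  proof -
    have "D.cls g = D.cls f" if "g \<in> C.cls f" for g
      using D.cls_eqI[OF term_equiv_mono[OF _ le], of f g] that by (simp add: C.mem_cls)
    then have "Fm (C.cls f) = (\<Union>g\<in>C.cls f. D.cls f)"
      unfolding Fm_def D.cls_def[symmetric] by (intro SUP_cong refl)
    then show ?thesis using C.cls_self[OF that] by auto
  qed
  have arE: "\<exists>f. typed \<C> f \<and> typed \<D> f \<and> X = C.cls f \<and> C.dm X = tdom f \<and> C.cd X = tcod f \<and> Fm X = D.cls f"
    if "C.ar X" for X :: "'p mterm set"
    using C.arE[OF that] Fm typed_mono by metis
  have "category_functor (free_category \<C>) (free_category \<D>) (\<lambda>A. A) Fm"
    unfolding category_functor_def category_functor_axioms_def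
  proof (intro conjI allI impI C.category_free D.category_free)
    fix A :: "'p obj"
    show "A \<in> Ob (free_category \<D>)" by (simp add: D.Ob_free)
    show "Fm (Ident (free_category \<C>) A) = Ident (free_category \<D>) A"
      by (simp add: C.Ident_free D.Ident_free Fm)
  next
    fix X and A B :: "'p obj" assume "X \<in> Hom (free_category \<C>) A B"
    then show "Fm X \<in> Hom (free_category \<D>) A B"
      using arE[of X] by (auto simp: C.Hom_free_iff D.Hom_free_iff D.ar_cls D.dm_cls D.cd_cls)
  next
    fix X Y and A B B' :: "'p obj"
    assume X: "X \<in> Hom (free_category \<C>) A B" and Y: "Y \<in> Hom (free_category \<C>) B B'"
    obtain f where f: "typed \<C> f" "X = C.cls f" "tcod f = B" "Fm X = D.cls f"
      using arE[of X] X by (auto simp: C.Hom_free_iff)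
    obtain g where g: "typed \<C> g" "Y = C.cls g" "tdom g = B" "Fm Y = D.cls g"
      using arE[of Y] Y by (auto simp: C.Hom_free_iff)
    have "Fm (C.cls (g \<bullet> f)) = D.cls (g \<bullet> f)" using f g by (intro Fm) simp
    then show "Fm (Cmp (free_category \<C>) Y X) = Cmp (free_category \<D>) (Fm Y) (Fm X)"
      using f g by (simp add: C.Cmp_free D.Cmp_free)
  qed
  moreover have "inj_on Fm (Mor (free_category \<C>))"
  proof (rule inj_onI)
    fix X Y assume "X \<in> Mor (free_category \<C>)" "Y \<in> Mor (free_category \<C>)" and eq: "Fm X = Fm Y"
    then obtain f g where f: "typed \<C> f" "typed \<D> f" "X = C.cls f" "Fm X = D.cls f"
      and g: "typed \<C> g" "typed \<D> g" "Y = C.cls g" "Fm Y = D.cls g"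
      using arE[of X] arE[of Y] by (auto simp: Mor_def C.Hom_free_iff)
    then have "(f, g) \<in> term_equiv \<D>" using eq D.cls_eq_iff[of f g] by simp
    \<comment> \<open>Equality in \<D> is used only through the action, which does not depend on the
      kind; equality in \<C> follows from it.\<close>
    then have "same_act \<D> TYPE(nat) f g" by (rule term_equiv_same_act)
    then show "X = Y"
      using C.cls_eqI_act_upt[OF kw f(1) g(1)] f g by (simp add: same_act_def)
  qed
  ultimately have "category_embedding (free_category \<C>) (free_category \<D>) (\<lambda>A. A) Fm"
    by (simp add: category_embedding_def category_embedding_axioms_def)
  moreover have "Fm (mclass \<C> f) = mclass \<D> f" if "\<C> \<turnstile> f : A \<rightarrow> B" for f A B
    using Fm that by (simp add: has_type_iff C.cls_def D.cls_def)
  ultimately show ?thesis unfolding free_subcategory_def by blast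
qed

theorem mainTheorem4:
  assumes "infinite (UNIV :: 'p::linorder set)"
  shows "free_subcategory TYPE('p) Mon SyMon \<and>
         free_subcategory TYPE('p) Mon Rel \<and>
         free_subcategory TYPE('p) Mon Aff \<and>
         free_subcategory TYPE('p) Mon Cart \<and>
         free_subcategory TYPE('p) SyMon Rel \<and>
         free_subcategory TYPE('p) SyMon Aff \<and>
         free_subcategory TYPE('p) SyMon Cart \<and>
         free_subcategory TYPE('p) Rel Cart \<and>
         free_subcategory TYPE('p) Aff Cart"
  by (intro conjI free_subcategory_if_faithful) (simp_all add: kind_le_def has_c_def has_w_def has_k_def)

end
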